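(* Let $[x^{\mathsf T},y^{\mathsf T}]^{\mathsf T}$ be the unique solution of the generalized saddle point problem $$\mathcal M\begin{bmatrix}x\\ y\end{bmatrix}=\begin{bmatrix}A&B^{\mathsf T}\\ B&D\end{bmatrix}\begin{bmatrix}x\\ y\end{bmatrix}=\begin{bmatrix}f\\ g\end{bmatrix}=\mathbf d$$ with the structure $\mathcal E$, i.e. $A\in\mathcal S_m$ symmetric, $B\in\mathcal T^{n\times m}$ Toeplitz and $D\in\mathbb R^{n\times n}$, and let $\mathbf L\in\mathbb R^{k\times(m+n)}$. Then the structured normwise, mixed and componentwise condition numbers of the linear function $\mathbf L[x^{\mathsf T},y^{\mathsf T}]^{\mathsf T}$ are, respectively, $$\mathscr K(\mathbf L[x^{\mathsf T},y^{\mathsf T}]^{\mathsf T};\mathcal E)=\frac{\left\|\mathbf L\mathcal M^{-1}\begin{bmatrix}\mathcal R\Phi_{\mathcal E}\mathfrak D_{\mathcal E}^{-1}&-I_{m+n}\end{bmatrix}\right\|_2\left\|\begin{bmatrix}\mathbf H&\mathbf d\end{bmatrix}\right\|_F}{\left\|\mathbf L[x^{\mathsf T},y^{\mathsf T}]^{\mathsf T}\right\|_2},$$ $$\mathscr M(\mathbf L[x^{\mathsf T},y^{\mathsf T}]^{\mathsf T};\mathcal E)=\frac{\left\||\mathbf L\mathcal M^{-1}\mathcal R\Phi_{\mathcal E}|\begin{bmatrix}\mathrm{vec}_{\mathcal S}(|A|)\\ \mathrm{vec}_{\mathcal T}(|B|)\\ \mathrm{vec}(|D|)\end{bmatrix}+|\mathbf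 L\mathcal M^{-1}|\begin{bmatrix}|f|\\ |g|\end{bmatrix}\right\|_\infty}{\left\|\mathbf L[x^{\mathsf T},y^{\mathsf T}]^{\mathsf T}\right\|_\infty},$$ $$\mathscr C(\mathbf L[x^{\mathsf T},y^{\mathsf T}]^{\mathsf T};\mathcal E)=\left\|\mathbf D^{\dagger}_{\mathbf L[x^{\mathsf T},y^{\mathsf T}]^{\mathsf T}}|\mathbf L\mathcal M^{-1}\mathcal R\Phi_{\mathcal E}|\begin{bmatrix}\mathrm{vec}_{\mathcal S}(|A|)\\ \mathrm{vec}_{\mathcal T}(|B|)\\ \mathrm{vec}(|D|)\end{bmatrix}+\mathbf D^{\dagger}_{\mathbf L[x^{\mathsf T},y^{\mathsf T}]^{\mathsf T}}|\mathbf L\mathcal M^{-1}|\begin{bmatrix}|f|\\ |g|\end{bmatrix}\right\|_\infty .$$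
   Context: Notation: $\|\cdot\|_2$ is the Euclidean norm of a vector / spectral norm of a matrix, $\|\cdot\|_\infty$ the infinity norm, $\|\cdot\|_F$ the Frobenius norm. $|X|$ is the entrywise absolute value, and $X\le Y$ for matrices is entrywise. $\mathrm{vec}$ stacks columns, $\otimes$ is the Kronecker product. For a vector $v$, $\mathbf D_v$ is the diagonal matrix with diagonal $v$; $\dagger$ is the Moore-Penrose inverse. Quotients of vectors are entrywise, with $0/0=0$ and $a/0=\infty$ for $a\ne0$. Setting and standing assumptions: $x,f\in\mathbb R^m$, $y,g\in\mathbb R^n$; $A\in\mathbb R^{m\times m}$ and $\mathcal M$ are nonsingular. It is assumed that $[x^{\mathsf T},y^{\mathsf T}]^{\mathsf T}\ne\mathbf 0$ for the mixed condition number and that all $x_i\neq0$ and $y_i\ne0$ for the componentwise one; moreover, as required for the condition numbers to be defined, $\mathbf L[x^{\mathsf T},y^{\mathsf T}]^{\mathsf T}\ne\mathbf 0$, with all entries nonzero in the componentwise case. Put $\mathbf H=\begin{bmatrix}A&\mathbf 0\\ B&D\end{bmatrix}$, $\mathbf d=\begin{bmatrix}f\\ g\end{bmatrix}$, and $$\mathcal R=\begin{bmatrix}x^{\mathsf T}\otimes I_m&I_m\otimes y^{\mathsf T}&\mathbf 0\\ \mathbf 0&x^{\mathsf T}\otimes I_n&y^{\mathsf T}\otimes I_n\end{bmatrix}.$$ Symmetric structure: $\mathcal S_m$ is the space of symmetric $m\times m$ real matrices, $p=m(m+1)/2$, and $\mathrm{vec}_{\mathcal S}(A)=[a_{11},\dots,a_{1m},a_{22},\dots,a_{2m},\dots,a_{(m-1)(m-1)},a_{(m-1)m},a_{mm}]^{\mathsf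 T}\in\mathbb R^p$. With $e_i$ the columns of $I_m$, $S_{ii}=e_ie_i^{\mathsf T}$ and $S_{ij}=e_ie_j^{\mathsf T}+e_je_i^{\mathsf T}$ for $i<j$; $\Phi_{\mathcal S_m}\in\mathbb R^{m^2\times p}$ has columns $\mathrm{vec}(S_{ij})$, $i\le j$, in the same order as the entries of $\mathrm{vec}_{\mathcal S}$. $\mathfrak D_{\mathcal S_m}\in\mathbb R^{p\times p}$ is diagonal with $\mathfrak D_{\mathcal S_m}(j,j)=1$ for $j=\frac{(2m-(i-2))(i-1)}2+1$, $i=1,\dots,m$ (the positions of the entries $a_{ii}$), and $\sqrt2$ otherwise; it satisfies $\|A\|_F=\|\mathfrak D_{\mathcal S_m}\mathrm{vec}_{\mathcal S}(A)\|_2$. Toeplitz structure: $\mathcal T^{n\times m}$ is the space of $n\times m$ real Toeplitz matrices $T=[t_{j-i}]$, with generator vector $\mathrm{vec}_{\mathcal T}(T)=[t_{-n+1},\dots,t_{-1},t_0,t_1,\dots,t_{m-1}]^{\mathsf T}\in\mathbb R^{m+n-1}$. For $-n+1\le i\le m-1$, $\mathcal J_i$ is the $n\times m$ Toeplitz matrix with $t_i=1$ and all other $t_l=0$; $\Phi_{\mathcal T_{nm}}=[\mathrm{vec}(\mathcal J_{-n+1}),\dots,\mathrm{vec}(\mathcal J_{m-1})]\in\mathbb R^{mn\times(m+n-1)}$. $\mathfrak D_{\mathcal T_{nm}}\in\mathbb R^{(m+n-1)\times(m+n-1)}$ is the diagonal matrix with $\mathfrak D_{\mathcal T_{nm}}(j,j)=\mathbf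 a_j$, where $$\mathbf a=[1,\sqrt2,\dots,\sqrt{n-1},\sqrt{\min\{m,n\}},\sqrt{m-1},\dots,\sqrt2,1]^{\mathsf T}\in\mathbb R^{m+n-1},$$ such that $\|T\|_F=\|\mathfrak D_{\mathcal T_{nm}}\mathrm{vec}_{\mathcal T}(T)\|_2$. $\Phi_{\mathcal E}=\mathrm{diag}(\Phi_{\mathcal S_m},\Phi_{\mathcal T_{nm}},I_{n^2})$ and $\mathfrak D_{\mathcal E}=\mathrm{diag}(\mathfrak D_{\mathcal S_m},\mathfrak D_{\mathcal T_{nm}},I_{n^2})$ (block diagonal). $\mathcal E=\left\{\begin{bmatrix}A&\mathbf 0\\ B&D\end{bmatrix}:A\in\mathcal S_m,\ B\in\mathcal T^{n\times m},\ D\in\mathbb R^{n\times n}\right\}$. For perturbations put $\Delta\mathbf H=\begin{bmatrix}\Delta A&\mathbf 0\\ \Delta B&\Delta D\end{bmatrix}$, $\Delta\mathbf d=\begin{bmatrix}\Delta f\\ \Delta g\end{bmatrix}$, and let $[(x+\Delta x)^{\mathsf T},(y+\Delta y)^{\mathsf T}]^{\mathsf T}$ be the unique solution (for small perturbations) of $$\begin{bmatrix}A+\Delta A&(B+\Delta B)^{\mathsf T}\\ B+\Delta B&D+\Delta D\end{bmatrix}\begin{bmatrix}x+\Delta x\\ y+\Delta y\end{bmatrix}=\begin{bmatrix}f+\Delta f\\ g+\Delta g\end{bmatrix}.$$ Structured condition numbers, writing $z=[x^{\mathsf T},y^{\mathsf T}]^{\mathsf T}$, $\Delta z=[\Delta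 x^{\mathsf T},\Delta y^{\mathsf T}]^{\mathsf T}$: $$\mathscr K(\mathbf Lz;\mathcal E)=\lim_{\eta\to0}\sup\left\{\frac{\|\mathbf L\Delta z\|_2}{\eta\|\mathbf Lz\|_2}:\|[\Delta\mathbf H\ \ \Delta\mathbf d]\|_F\le\eta\|[\mathbf H\ \ \mathbf d]\|_F,\ \Delta\mathbf H\in\mathcal E\right\},$$ $$\mathscr M(\mathbf Lz;\mathcal E)=\lim_{\eta\to0}\sup\left\{\frac{\|\mathbf L\Delta z\|_\infty}{\eta\|\mathbf Lz\|_\infty}:|[\Delta\mathbf H\ \ \Delta\mathbf d]|\le\eta|[\mathbf H\ \ \mathbf d]|,\ \Delta\mathbf H\in\mathcal E\right\},$$ $$\mathscr C(\mathbf Lz;\mathcal E)=\lim_{\eta\to0}\sup\left\{\frac1\eta\left\|\frac{\mathbf L\Delta z}{\mathbf Lz}\right\|_\infty:|[\Delta\mathbf H\ \ \Delta\mathbf d]|\le\eta|[\mathbf H\ \ \mathbf d]|,\ \Delta\mathbf H\in\mathcal E\right\}.$$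
   Formalization: The Toeplitz weights are taken as a_j = sqrt(min{j, m, n, m+n-j}), as the identity ‖T‖_F = ‖D_T vec_T(T)‖_2 requires; the printed list violates it when |m-n| ≥ 2, where the normwise formula with the printed list can fail. *)

theory Defs
  imports
    "Jordan_Normal_Form.Matrix"
    "Jordan_Normal_Form.Gauss_Jordan_Elimination"
    "HOL-Library.Extended_Real"
begin

section \<open>Norms, absolute values, inverses\<close>

definition norm2 :: "real vec \<Rightarrow> real" where
  "norm2 v = sqrt (\<Sum>i<dim_vec v. (v $ i)\<^sup>2)"

text \<open>Only used for vectors of positive dimension.\<close>

definition norm_inf :: "real vec \<Rightarrow> real" where
  "norm_inf v = Max ((\<lambda>i. \<bar>v $ i\<bar>) ` {..<dim_vec v})"

definition frob_norm :: "real mat \<Rightarrow> real" where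
  "frob_norm A = sqrt (\<Sum>i<dim_row A. \<Sum>j<dim_col A. (A $$ (i,j))\<^sup>2)"

definition spectral_norm :: "real mat \<Rightarrow> real" where
  "spectral_norm A = (SUP v \<in> {v \<in> carrier_vec (dim_col A). norm2 v \<le> 1}. norm2 (A *\<^sub>v v))"

abbreviation abs_vec :: "real vec \<Rightarrow> real vec" where
  "abs_vec v \<equiv> map_vec abs v"

abbreviation abs_mat :: "real mat \<Rightarrow> real mat" where
  "abs_mat A \<equiv> map_mat abs A"

text \<open>Entrywise quotients with \<open>0/0 = 0\<close> and \<open>a/0 = \<infinity>\<close> for nonzero \<open>a\<close>
  (in contrast to the convention \<open>a/0 = 0\<close> of the division on the reals).\<close>

definition quot :: "real \<Rightarrow> real \<Rightarrow> ereal" where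
  "quot a b = (if b = 0 then (if a = 0 then 0 else \<infinity>) else ereal (a / b))"

definition norm_inf_quot :: "real vec \<Rightarrow> real vec \<Rightarrow> ereal" where
  "norm_inf_quot v w = Max ((\<lambda>i. \<bar>quot (v $ i) (w $ i)\<bar>) ` {..<dim_vec v})"

text \<open>The inverse of a nonsingular matrix (unspecified for a singular one).\<close>

definition mat_inv :: "real mat \<Rightarrow> real mat" where
  "mat_inv A = the (mat_inverse A)"

definition is_moore_penrose :: "real mat \<Rightarrow> real mat \<Rightarrow> bool" where
  "is_moore_penrose A X \<longleftrightarrow>
     X \<in> carrier_mat (dim_col A) (dim_row A) \<and>
     A * X * A = A \<and> X * A * X = X \<and>
     transpose_mat (A * X) = A * X \<and> transpose_mat (X * A) = X * A"

definition moore_penrose :: "real mat \<Rightarrow> real mat" where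
  "moore_penrose A = (THE X. is_moore_penrose A X)"

section \<open>Block and Kronecker constructions\<close>

definition append_cols :: "real mat \<Rightarrow> real mat \<Rightarrow> real mat" (infixr \<open>@\<^sub>c\<close> 66) where
  "A @\<^sub>c B = four_block_mat A B (0\<^sub>m 0 (dim_col A)) (0\<^sub>m 0 (dim_col B))"

definition mat_of_col :: "real vec \<Rightarrow> real mat" where
  "mat_of_col v = mat_of_cols (dim_vec v) [v]"

definition diag_of_vec :: "real vec \<Rightarrow> real mat" where
  "diag_of_vec v = mat_diag (dim_vec v) (\<lambda>i. v $ i)"

definition kronecker :: "real mat \<Rightarrow> real mat \<Rightarrow> real mat" (infixl \<open>\<otimes>\<^sub>K\<close> 70) where
  "A \<otimes>\<^sub>K B = mat (dim_row A * dim_row B) (dim_col A * dim_col B)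
     (\<lambda>(i,j). A $$ (i div dim_row B, j div dim_col B) * B $$ (i mod dim_row B, j mod dim_col B))"

text \<open>The operator vec: the columns are stacked on top of each other.\<close>

definition vectorize :: "real mat \<Rightarrow> real vec" where
  "vectorize A = vec (dim_row A * dim_col A) (\<lambda>k. A $$ (k mod dim_row A, k div dim_row A))"

section \<open>Symmetric structure\<close>

definition sym_mats :: "nat \<Rightarrow> real mat set" where
  "sym_mats m = {A \<in> carrier_mat m m. transpose_mat A = A}"

text \<open>The (0-based) index pairs \<open>(i,j)\<close> with \<open>i \<le> j\<close>, row by row.\<close>

definition sym_idx :: "nat \<Rightarrow> (nat \<times> nat) list" where
  "sym_idx m = concat (map (\<lambda>i. map (\<lambda>j. (i,j)) [i..<m]) [0..<m])"

definition vec_sym :: "real mat \<Rightarrow> real vec" where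
  "vec_sym A = vec_of_list (map (\<lambda>(i,j). A $$ (i,j)) (sym_idx (dim_row A)))"

definition sym_basis :: "nat \<Rightarrow> nat \<times> nat \<Rightarrow> real mat" where
  "sym_basis m = (\<lambda>(i,j). mat m m (\<lambda>(r,s). if (r,s) = (i,j) \<or> (r,s) = (j,i) then 1 else 0))"

definition Phi_sym :: "nat \<Rightarrow> real mat" where
  "Phi_sym m = mat_of_cols (m * m) (map (\<lambda>ij. vectorize (sym_basis m ij)) (sym_idx m))"

text \<open>The position formula for the diagonal entries is 1-based; \<open>2 * m + 2 - i\<close> is
  \<open>2 * m - (i - 2)\<close> written so that subtraction on the naturals does not truncate.\<close>

definition D_sym :: "nat \<Rightarrow> real mat" where
  "D_sym m = mat_diag (m * (m + 1) div 2)
     (\<lambda>j. if \<exists>i\<in>{1..m}. j + 1 = (2 * m + 2 - i) * (i - 1) div 2 + 1 then 1 else sqrt 2)"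

section \<open>Toeplitz structure\<close>

definition toeplitz_mats :: "nat \<Rightarrow> nat \<Rightarrow> real mat set" where
  "toeplitz_mats n m = {T \<in> carrier_mat n m.
     \<exists>t :: int \<Rightarrow> real. \<forall>i<n. \<forall>j<m. T $$ (i,j) = t (int j - int i)}"

text \<open>The generator \<open>t\<^sub>l\<close> is read off the first column (\<open>l < 0\<close>) or the first row (\<open>l \<ge> 0\<close>).\<close>

definition toeplitz_gen :: "real mat \<Rightarrow> int \<Rightarrow> real" where
  "toeplitz_gen T l = (if l < 0 then T $$ (nat (- l), 0) else T $$ (0, nat l))"

definition vec_toeplitz :: "real mat \<Rightarrow> real vec" where
  "vec_toeplitz T =
     vec_of_list (map (toeplitz_gen T) [1 - int (dim_row T) .. int (dim_col T) - 1])"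

definition toeplitz_basis :: "nat \<Rightarrow> nat \<Rightarrow> int \<Rightarrow> real mat" where
  "toeplitz_basis n m l = mat n m (\<lambda>(i,j). if int j - int i = l then 1 else 0)"

definition Phi_toeplitz :: "nat \<Rightarrow> nat \<Rightarrow> real mat" where
  "Phi_toeplitz n m =
     mat_of_cols (n * m) (map (\<lambda>l. vectorize (toeplitz_basis n m l)) [1 - int n .. int m - 1])"

text \<open>The \<open>j\<close>-th diagonal entry (1-based) is \<open>sqrt (min {j, m, n, m + n - j})\<close>, the square root of
  the length of the \<open>j\<close>-th diagonal of an \<open>n \<times> m\<close> matrix: the sequence
  \<open>1, sqrt 2, \<dots>, sqrt (min m n), \<dots>, sqrt 2, 1\<close>, never exceeding \<open>sqrt (min m n)\<close>.
  The list \<open>1, sqrt 2, \<dots>, sqrt (n-1), sqrt (min m n), sqrt (m-1), \<dots>, sqrt 2, 1\<close> without the cap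
  agrees with it exactly if \<open>m\<close> and \<open>n\<close> differ by at most 1; otherwise that list violates the
  characteristic identity \<open>frob_norm_toeplitz\<close> below.\<close>

definition D_toeplitz :: "nat \<Rightarrow> nat \<Rightarrow> real mat" where
  "D_toeplitz n m = mat_diag (m + n - 1)
     (\<lambda>j. sqrt (real (Min {j + 1, m, n, m + n - (j + 1)})))"

section \<open>The saddle point problem with structure\<close>

definition saddle_mat :: "real mat \<Rightarrow> real mat \<Rightarrow> real mat \<Rightarrow> real mat" where
  "saddle_mat A B D = four_block_mat A (transpose_mat B) B D"

definition H_mat :: "real mat \<Rightarrow> real mat \<Rightarrow> real mat \<Rightarrow> real mat" where
  "H_mat A B D = four_block_mat A (0\<^sub>m (dim_row A) (dim_col D)) B D"

definition struct_E :: "nat \<Rightarrow> nat \<Rightarrow> real mat set" where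
  "struct_E m n = {H_mat A B D | A B D.
     A \<in> sym_mats m \<and> B \<in> toeplitz_mats n m \<and> D \<in> carrier_mat n n}"

definition R_mat :: "real vec \<Rightarrow> real vec \<Rightarrow> real mat" where
  "R_mat x y = (let m = dim_vec x; n = dim_vec y in
     ((mat_of_row x \<otimes>\<^sub>K 1\<^sub>m m) @\<^sub>c (1\<^sub>m m \<otimes>\<^sub>K mat_of_row y) @\<^sub>c 0\<^sub>m m (n * n)) @\<^sub>r
     (0\<^sub>m n (m * m) @\<^sub>c (mat_of_row x \<otimes>\<^sub>K 1\<^sub>m n) @\<^sub>c (mat_of_row y \<otimes>\<^sub>K 1\<^sub>m n)))"

definition Phi_E :: "nat \<Rightarrow> nat \<Rightarrow> real mat" where
  "Phi_E m n = diag_block_mat [Phi_sym m, Phi_toeplitz n m, 1\<^sub>m (n * n)]"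

definition D_E :: "nat \<Rightarrow> nat \<Rightarrow> real mat" where
  "D_E m n = diag_block_mat [D_sym m, D_toeplitz n m, 1\<^sub>m (n * n)]"

definition unique_solution :: "real mat \<Rightarrow> real vec \<Rightarrow> real vec \<Rightarrow> bool" where
  "unique_solution M b z \<longleftrightarrow>
     z \<in> carrier_vec (dim_col M) \<and> M *\<^sub>v z = b \<and>
     (\<forall>z' \<in> carrier_vec (dim_col M). M *\<^sub>v z' = b \<longrightarrow> z' = z)"

section \<open>Structured condition numbers\<close>

text \<open>All triples \<open>(\<Delta>H, \<Delta>d, \<Delta>z)\<close> of a structured perturbation of the data for which the perturbed
  system is uniquely solvable (automatic for small perturbations), and the resulting change of the
  solution.\<close>

definition perturbations ::
  "real mat \<Rightarrow> real mat \<Rightarrow> real mat \<Rightarrow> real vec \<Rightarrow> real vec \<Rightarrow> real vec \<Rightarrow> real vec \<Rightarrow>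
   (real mat \<times> real vec \<times> real vec) set" where
  "perturbations A B D f g x y = (let m = dim_row A; n = dim_row D in
     {(H_mat dA dB dD, df @\<^sub>v dg, dx @\<^sub>v dy) | dA dB dD df dg dx dy.
        dA \<in> carrier_mat m m \<and> dB \<in> carrier_mat n m \<and> dD \<in> carrier_mat n n \<and>
        df \<in> carrier_vec m \<and> dg \<in> carrier_vec n \<and> dx \<in> carrier_vec m \<and> dy \<in> carrier_vec n \<and>
        H_mat dA dB dD \<in> struct_E m n \<and>
        unique_solution (saddle_mat (A + dA) (B + dB) (D + dD))
          ((f + df) @\<^sub>v (g + dg)) ((x + dx) @\<^sub>v (y + dy))})"

definition normwise_sup ::
  "real mat \<Rightarrow> real mat \<Rightarrow> real mat \<Rightarrow> real mat \<Rightarrow> real vec \<Rightarrow> real vec \<Rightarrow> real vec \<Rightarrow> real vec \<Rightarrow>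
   real \<Rightarrow> ereal" where
  "normwise_sup L A B D f g x y \<eta> =
     Sup {ereal (norm2 (L *\<^sub>v dz) / (\<eta> * norm2 (L *\<^sub>v (x @\<^sub>v y)))) | dH dd dz.
       (dH, dd, dz) \<in> perturbations A B D f g x y \<and>
       frob_norm (dH @\<^sub>c mat_of_col dd)
         \<le> \<eta> * frob_norm (H_mat A B D @\<^sub>c mat_of_col (f @\<^sub>v g))}"

definition mixed_sup ::
  "real mat \<Rightarrow> real mat \<Rightarrow> real mat \<Rightarrow> real mat \<Rightarrow> real vec \<Rightarrow> real vec \<Rightarrow> real vec \<Rightarrow> real vec \<Rightarrow>
   real \<Rightarrow> ereal" where
  "mixed_sup L A B D f g x y \<eta> =
     Sup {ereal (norm_inf (L *\<^sub>v dz) / (\<eta> * norm_inf (L *\<^sub>v (x @\<^sub>v y)))) | dH dd dz.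
       (dH, dd, dz) \<in> perturbations A B D f g x y \<and>
       abs_mat (dH @\<^sub>c mat_of_col dd)
         \<le> \<eta> \<cdot>\<^sub>m abs_mat (H_mat A B D @\<^sub>c mat_of_col (f @\<^sub>v g))}"

definition componentwise_sup ::
  "real mat \<Rightarrow> real mat \<Rightarrow> real mat \<Rightarrow> real mat \<Rightarrow> real vec \<Rightarrow> real vec \<Rightarrow> real vec \<Rightarrow> real vec \<Rightarrow>
   real \<Rightarrow> ereal" where
  "componentwise_sup L A B D f g x y \<eta> =
     Sup {ereal (1 / \<eta>) * norm_inf_quot (L *\<^sub>v dz) (L *\<^sub>v (x @\<^sub>v y)) | dH dd dz.
       (dH, dd, dz) \<in> perturbations A B D f g x y \<and>
       abs_mat (dH @\<^sub>c mat_of_col dd)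
         \<le> \<eta> \<cdot>\<^sub>m abs_mat (H_mat A B D @\<^sub>c mat_of_col (f @\<^sub>v g))}"

text \<open>\<open>Lim\<close> is only meaningful if the limit exists.\<close>

definition normwise_cond ::
  "real mat \<Rightarrow> real mat \<Rightarrow> real mat \<Rightarrow> real mat \<Rightarrow> real vec \<Rightarrow> real vec \<Rightarrow> real vec \<Rightarrow> real vec \<Rightarrow>
   ereal" where
  "normwise_cond L A B D f g x y = Lim (at_right 0) (normwise_sup L A B D f g x y)"

definition mixed_cond ::
  "real mat \<Rightarrow> real mat \<Rightarrow> real mat \<Rightarrow> real mat \<Rightarrow> real vec \<Rightarrow> real vec \<Rightarrow> real vec \<Rightarrow> real vec \<Rightarrow>
   ereal" where
  "mixed_cond L A B D f g x y = Lim (at_right 0) (mixed_sup L A B D f g x y)"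

definition componentwise_cond ::
  "real mat \<Rightarrow> real mat \<Rightarrow> real mat \<Rightarrow> real mat \<Rightarrow> real vec \<Rightarrow> real vec \<Rightarrow> real vec \<Rightarrow> real vec \<Rightarrow>
   ereal" where
  "componentwise_cond L A B D f g x y = Lim (at_right 0) (componentwise_sup L A B D f g x y)"

section \<open>Characteristic identities of the weight matrices\<close>

lemma set_sym_idx: "set (sym_idx m) = {(i,j). i \<le> j \<and> j < m}"
  by (fastforce simp: sym_idx_def)

lemma distinct_sym_idx: "distinct (sym_idx m)"
  unfolding sym_idx_def
proof (rule distinct_concat)
  have "x = y" if "x < m" "y < m" "map (Pair x) [x..<m] = map (Pair y) [y..<m]" for x y
    using that(1,2) arg_cong[OF that(3), of length] by simp
  then show "distinct (map (\<lambda>i. map (Pair i) [i..<m]) [0..<m])"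
    by (auto simp: distinct_map inj_on_def)
qed (auto simp: distinct_map inj_on_def)

text \<open>The 0-based position of the entry \<open>(i,i)\<close> (0-based \<open>i\<close>) in the enumeration \<open>sym_idx\<close>.\<close>

definition sym_off :: "nat \<Rightarrow> nat \<Rightarrow> nat" where
  "sym_off m i = (2 * m + 1 - i) * i div 2"

lemma sym_off_Suc: "i < m \<Longrightarrow> sym_off m (Suc i) = sym_off m i + (m - i)"
proof -
  assume "i < m"
  then obtain d where m: "m = i + d" and "d > 0" using less_imp_add_positive by blast
  have "(2 * m + 1 - Suc i) * Suc i = (2 * m + 1 - i) * i + (m - i) * 2"
    unfolding m by (simp add: algebra_simps)
  then show ?thesis unfolding sym_off_def by simp
qed

lemma length_pre: "r \<le> m \<Longrightarrow> length (concat (map (\<lambda>i. map (\<lambda>j. (i,j)) [i..<m]) [0..<r])) = sym_off m r"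
proof (induction r)
  case 0 then show ?case by (simp add: sym_off_def)
next
  case (Suc r) then show ?case by (simp add: sym_off_Suc)
qed

lemma length_sym_idx: "length (sym_idx m) = m * (m + 1) div 2"
  using length_pre[of m m] by (simp add: sym_idx_def sym_off_def mult.commute)

lemma nth_sym_idx: assumes "i < m" "s < m - i"
  shows "sym_off m i + s < length (sym_idx m) \<and> sym_idx m ! (sym_off m i + s) = (i, i + s)"
proof -
  let ?R = "\<lambda>i. map (\<lambda>j. (i,j)) [i..<m]"
  have "[0..<m] = [0..<i] @ i # [Suc i..<m]" using assms
    by (metis le_add_diff_inverse less_imp_le_nat upt_add_eq_append upt_conv_Cons zero_le)
  then have "sym_idx m = concat (map ?R [0..<i]) @ ?R i @ concat (map ?R [Suc i..<m])"
    unfolding sym_idx_def by simp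
  then show ?thesis using length_pre[of i m] assms by (auto simp: nth_append)
qed

lemma diag_pos: assumes p: "p < length (sym_idx m)"
  shows "(\<exists>i\<in>{1..m}. p + 1 = (2 * m + 2 - i) * (i - 1) div 2 + 1) \<longleftrightarrow>
         fst (sym_idx m ! p) = snd (sym_idx m ! p)" (is "?l = ?r")
proof
  assume ?l
  then obtain i where i: "i \<in> {1..m}" "p = (2 * m + 2 - i) * (i - 1) div 2" by auto
  then have "p = sym_off m (i - 1) + 0" unfolding sym_off_def by (cases i) auto
  with nth_sym_idx[of "i - 1" m 0] i show ?r by auto
next
  assume r: ?r
  obtain i j where ij: "sym_idx m ! p = (i,j)" by force
  from p have "(i,j) \<in> set (sym_idx m)" using ij nth_mem by metis
  with r ij have i: "i < m" "j = i" by (auto simp: set_sym_idx)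
  with nth_sym_idx[of i m 0] have "sym_off m i < length (sym_idx m)" "sym_idx m ! sym_off m i = (i,i)" by auto
  with ij i p distinct_sym_idx have "p = sym_off m i" by (metis nth_eq_iff_index_eq)
  with i show ?l by (intro bexI[of _ "Suc i"]) (auto simp: sym_off_def)
qed

lemma norm2_mat_diag: assumes "dim_vec v = n"
  shows "norm2 (mat_diag n w *\<^sub>v v) = sqrt (\<Sum>j<n. (w j * v $ j)\<^sup>2)"
proof -
  have "(mat_diag n w *\<^sub>v v) $ j = w j * v $ j" if "j < n" for j
  proof -
    have "(mat_diag n w *\<^sub>v v) $ j = (\<Sum>i = 0..<n. (if j = i then w i else 0) * v $ i)"
      using that assms by (simp add: mat_diag_def scalar_prod_def)
    also have "\<dots> = (\<Sum>i = 0..<n. if j = i then w i * v $ i else 0)" by (rule sum.cong) auto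
    also have "\<dots> = w j * v $ j" using that by simp
    finally show ?thesis .
  qed
  then show ?thesis unfolding norm2_def by (simp add: mat_diag_def)
qed

lemma frob_norm_sym:
  assumes "A \<in> sym_mats m"
  shows "frob_norm A = norm2 (D_sym m *\<^sub>v vec_sym A)"
proof -
  have A: "dim_row A = m" "dim_col A = m" and s: "\<And>i j. i < m \<Longrightarrow> j < m \<Longrightarrow> A $$ (i,j) = A $$ (j,i)"
    using assms unfolding sym_mats_def by (auto, metis carrier_matD index_transpose_mat(1))
  let ?N = "length (sym_idx m)"
  let ?w = "\<lambda>(i::nat,j). if i = j then 1 else (2::real)"
  let ?F = "\<lambda>(i,j). ?w (i,j) * (A $$ (i,j))\<^sup>2"
  have N: "m * (m + 1) div 2 = ?N" by (simp add: length_sym_idx)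
  have dv: "dim_vec (vec_sym A) = ?N" by (simp add: vec_sym_def A)
  have "norm2 (D_sym m *\<^sub>v vec_sym A) =
     sqrt (\<Sum>p<?N. ((if \<exists>i\<in>{1..m}. p + 1 = (2 * m + 2 - i) * (i - 1) div 2 + 1 then 1 else sqrt 2)
          * vec_sym A $ p)\<^sup>2)"
    unfolding D_sym_def N by (rule norm2_mat_diag[OF dv])
  also have "(\<Sum>p<?N. ((if \<exists>i\<in>{1..m}. p + 1 = (2 * m + 2 - i) * (i - 1) div 2 + 1 then 1 else sqrt 2)
          * vec_sym A $ p)\<^sup>2) = (\<Sum>p<?N. ?F (sym_idx m ! p))"
  proof (rule sum.cong[OF refl])
    fix p assume "p \<in> {..<?N}"
    then have p: "p < ?N" by simp
    have "vec_sym A $ p = A $$ (sym_idx m ! p)"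
      using p by (simp add: vec_sym_def A vec_of_list_index case_prod_beta)
    then show "((if \<exists>i\<in>{1..m}. p + 1 = (2 * m + 2 - i) * (i - 1) div 2 + 1 then 1 else sqrt 2)
          * vec_sym A $ p)\<^sup>2 = ?F (sym_idx m ! p)"
      unfolding diag_pos[OF p] by (simp add: case_prod_beta power_mult_distrib)
  qed
  also have "\<dots> = sum ?F (set (sym_idx m))"
    by (rule sum.reindex_bij_betw[OF bij_betw_nth[OF distinct_sym_idx]]) auto
  also have "\<dots> = (\<Sum>i<m. \<Sum>j<m. (A $$ (i,j))\<^sup>2)"
  proof -
    let ?a = "\<lambda>(i,j). (A $$ (i,j))\<^sup>2"
    let ?U = "{(i,j). i < j \<and> j < m}" and ?L = "{(i,j). j < i \<and> i < m}" and ?D = "{(i,j). i = j \<and> i < m}"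
    have fin: "finite ?U" "finite ?L" "finite ?D"
      by (rule finite_subset[of _ "{..<m} \<times> {..<m}"]; auto)+
    have LU: "sum ?a ?L = sum ?a ?U"
      by (rule sum.reindex_bij_witness[of _ prod.swap prod.swap]) (auto simp: s)
    have "set (sym_idx m) = ?U \<union> ?D" by (auto simp: set_sym_idx)
    then have "sum ?F (set (sym_idx m)) = sum ?F ?U + sum ?F ?D"
      using fin by (simp add: sum.union_disjoint disjoint_iff)
    also have "sum ?F ?U = sum ?a ?U + sum ?a ?U"
      unfolding sum.distrib[symmetric] by (rule sum.cong) auto
    also have "sum ?F ?D = sum ?a ?D" by (rule sum.cong) (auto simp: case_prod_beta)
    also have "sum ?a ?U + sum ?a ?U + sum ?a ?D = sum ?a (?U \<union> ?D \<union> ?L)"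
      using fin LU by (subst sum.union_disjoint; (subst sum.union_disjoint)?; auto)
    also have "?U \<union> ?D \<union> ?L = {..<m} \<times> {..<m}" by auto
    finally show ?thesis by (simp add: sum.cartesian_product)
  qed
  finally show ?thesis by (simp add: frob_norm_def A)
qed

lemma card_diagonal:
  assumes "j < m + n - 1"
  shows "card {(r,s). r < n \<and> s < m \<and> int s - int r = int j + 1 - int n} = Min {j + 1, m, n, m + n - (j + 1)}"
proof -
  let ?S = "{(r,s). r < n \<and> s < m \<and> int s - int r = int j + 1 - int n}"
  have "?S = (\<lambda>r. (r, r + j + 1 - n)) ` {n - (j + 1) ..< min n (m + n - (j + 1))}"
    using assms by (auto simp: image_iff)
  moreover have "inj_on (\<lambda>r. (r, r + j + 1 - n)) {n - (j + 1) ..< min n (m + n - (j + 1))}"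
    by (auto simp: inj_on_def)
  ultimately have "card ?S = min n (m + n - (j + 1)) - (n - (j + 1))" by (simp add: card_image)
  then show ?thesis using assms by (auto simp: min_def)
qed

lemma frob_norm_toeplitz:
  assumes "T \<in> toeplitz_mats n m" "n > 0" "m > 0"
  shows "frob_norm T = norm2 (D_toeplitz n m *\<^sub>v vec_toeplitz T)"
proof -
  from assms obtain t where T: "dim_row T = n" "dim_col T = m"
    and t: "\<And>i j. i < n \<Longrightarrow> j < m \<Longrightarrow> T $$ (i,j) = t (int j - int i)"
    unfolding toeplitz_mats_def by auto
  let ?l = "\<lambda>j. int j + 1 - int n"
  let ?P = "{..<n} \<times> {..<m}"
  let ?pos = "\<lambda>(r,s). s + n - (r + 1)"
  have dv: "dim_vec (vec_toeplitz T) = m + n - 1" using assms by (simp add: vec_toeplitz_def T)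
  have gen: "vec_toeplitz T $ j = t (?l j)" if "j < m + n - 1" for j
  proof -
    have "vec_toeplitz T $ j = toeplitz_gen T (1 - int n + int j)"
      using that assms by (simp add: vec_toeplitz_def T vec_of_list_index)
    also have "\<dots> = t (?l j)"
      unfolding toeplitz_gen_def using that assms by (auto simp: t algebra_simps)
    finally show ?thesis .
  qed
  have "(\<Sum>i<n. \<Sum>j<m. (T $$ (i,j))\<^sup>2) = (\<Sum>(r,s)\<in>?P. (t (int s - int r))\<^sup>2)"
    by (simp add: sum.cartesian_product[symmetric] t)
  also have "\<dots> = (\<Sum>j<m + n - 1. \<Sum>(r,s)\<in>{p \<in> ?P. ?pos p = j}. (t (int s - int r))\<^sup>2)"
    by (subst sum.group) auto
  also have "\<dots> = (\<Sum>j<m + n - 1. (sqrt (real (Min {j + 1, m, n, m + n - (j + 1)})) * vec_toeplitz T $ j)\<^sup>2)"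
  proof (rule sum.cong[OF refl])
    fix j assume "j \<in> {..<m + n - 1}"
    then have j: "j < m + n - 1" by simp
    have S: "{p \<in> ?P. ?pos p = j} = {(r,s). r < n \<and> s < m \<and> int s - int r = ?l j}" by auto
    have "(\<Sum>(r,s)\<in>{p \<in> ?P. ?pos p = j}. (t (int s - int r))\<^sup>2) = (\<Sum>p\<in>{p \<in> ?P. ?pos p = j}. (t (?l j))\<^sup>2)"
      unfolding S by (rule sum.cong) auto
    also have "\<dots> = real (Min {j + 1, m, n, m + n - (j + 1)}) * (t (?l j))\<^sup>2"
      by (simp only: sum_constant S card_diagonal[OF j])
    finally show "(\<Sum>(r,s)\<in>{p \<in> ?P. ?pos p = j}. (t (int s - int r))\<^sup>2) =
      (sqrt (real (Min {j + 1, m, n, m + n - (j + 1)})) * vec_toeplitz T $ j)\<^sup>2"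
      by (simp add: gen[OF j] power_mult_distrib del: Min_insert)
  qed
  finally show ?thesis
    unfolding D_toeplitz_def norm2_mat_diag[OF dv] by (simp add: frob_norm_def T)
qed

end

theory Submission
  imports Defs "Jordan_Normal_Form.Determinant" "HOL-Analysis.L2_Norm"
begin

text \<open>Write \<open>M\<close> for the saddle point matrix, \<open>z = (x, y)\<close>, \<open>d = (f, g)\<close>, and let \<open>E\<close> be the saddle point
  matrix of a perturbation \<open>(dA, dB, dD)\<close> and \<open>e\<close> the perturbation of \<open>d\<close>. From \<open>(M + E) (z + dz) = d + e\<close> and
  \<open>M z = d\<close> follows \<open>dz = M\<^sup>-\<^sup>1 (e - E z) - M\<^sup>-\<^sup>1 E dz\<close>. If the entries of \<open>E\<close> and \<open>e\<close> are of order \<open>\<eta>\<close>, the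
  last term is of order \<open>\<eta>\<^sup>2\<close>, and the perturbed system is uniquely solvable for small \<open>\<eta>\<close>
  (\<open>perturbed_system\<close>). Hence each of the three suprema converges as soon as the supremum of the size of
  the linear part \<open>L M\<^sup>-\<^sup>1 (e - E z)\<close> is \<open>\<eta> V\<close> (\<open>sup_tendsto\<close>), and only this \<open>V\<close> remains to be found.

  The structured perturbations are parametrized bijectively by their generators: \<open>gen_vec\<close> stacks
  \<open>vec\<^sub>S dA\<close>, \<open>vec\<^sub>T dB\<close> and \<open>vec dD\<close>, every vector of the right length arises (\<open>gen_vec_surj\<close>), and
  \<open>E z = \<R> \<Phi> gen_vec\<close> (\<open>Phi_E_mult\<close>, \<open>R_mat_mult\<close>). So the linear part is a matrix applied to a vector
  that ranges freely over the set cut out by the size restriction.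

  In the normwise case this set is a Euclidean ball in the coordinates weighted by \<open>D_E\<close>
  (\<open>frob_norm_data_sq\<close>), and \<open>V\<close> is a spectral norm times the radius. In the other two cases it is a box,
  because the entries of a structured matrix that are not structurally zero are exactly its generators
  (\<open>H_mat_abs_le_iff\<close>); a row of the matrix attains its maximum over a box at a corner given by the
  signs of the row, which yields the absolute values in the formulas. These two cases differ only in the
  weights of a maximum norm (\<open>weighted_sup_tendsto\<close>).\<close>

section \<open>Norms of vectors and matrices\<close>

lemma index_mult_mat_vec_sum:
  assumes "i < dim_row A" "dim_vec v = dim_col A"
  shows "(A *\<^sub>v v) $ i = (\<Sum>j<dim_col A. A $$ (i,j) * v $ j)"
  using assms by (simp add: scalar_prod_def atLeast0LessThan)

lemma mult_mat_vec_uminus: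
  fixes A :: "real mat"
  shows "dim_vec v = dim_col A \<Longrightarrow> A *\<^sub>v (- v) = - (A *\<^sub>v v)"
  by (intro eq_vecI) (simp_all add: scalar_prod_def sum_negf)

lemma norm2_L2_set: "norm2 v = L2_set (($) v) {..<dim_vec v}"
  by (simp add: norm2_def L2_set_def)

lemma norm2_nonneg: "norm2 v \<ge> 0"
  by (simp add: norm2_def sum_nonneg)

lemma norm2_smult: "norm2 (c \<cdot>\<^sub>v v) = \<bar>c\<bar> * norm2 v"
  by (simp add: norm2_def power_mult_distrib sum_distrib_left[symmetric] real_sqrt_mult)

lemma norm2_uminus: "norm2 (- v) = norm2 v"
  by (simp add: norm2_def)

lemma norm2_eq_0_iff: "v \<in> carrier_vec n \<Longrightarrow> norm2 v = 0 \<longleftrightarrow> v = 0\<^sub>v n"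
  by (auto simp: norm2_L2_set L2_set_eq_0_iff)

lemma norm2_le_add_entries:
  assumes "dim_vec v = k" "dim_vec w = k" "\<And>i. i < k \<Longrightarrow> \<bar>v $ i - w $ i\<bar> \<le> e"
  shows "norm2 v \<le> norm2 w + k * e"
proof -
  have "norm2 v = L2_set (\<lambda>i. w $ i + (v $ i - w $ i)) {..<k}"
    by (simp add: norm2_L2_set assms)
  also have "\<dots> \<le> L2_set (($) w) {..<k} + L2_set (\<lambda>i. v $ i - w $ i) {..<k}"
    by (rule L2_set_triangle_ineq)
  also have "L2_set (\<lambda>i. v $ i - w $ i) {..<k} \<le> (\<Sum>i<k. \<bar>v $ i - w $ i\<bar>)"
    by (rule L2_set_le_sum_abs)
  also have "\<dots> \<le> (\<Sum>i<k. e)"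
    by (rule sum_mono) (simp add: assms)
  finally show ?thesis by (simp add: norm2_L2_set assms)
qed

lemma frob_norm_nonneg: "frob_norm A \<ge> 0"
  by (simp add: frob_norm_def sum_nonneg)

lemma frob_norm_sq: "(frob_norm A)\<^sup>2 = (\<Sum>i<dim_row A. \<Sum>j<dim_col A. (A $$ (i,j))\<^sup>2)"
  by (simp add: frob_norm_def sum_nonneg)

lemma abs_entry_le_frob_norm:
  assumes "i < dim_row A" "j < dim_col A"
  shows "\<bar>A $$ (i,j)\<bar> \<le> frob_norm A"
proof -
  have "(A $$ (i,j))\<^sup>2 \<le> (\<Sum>j<dim_col A. (A $$ (i,j))\<^sup>2)"
    using assms by (intro member_le_sum) auto
  also have "\<dots> \<le> (\<Sum>i<dim_row A. \<Sum>j<dim_col A. (A $$ (i,j))\<^sup>2)"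
    using assms by (intro member_le_sum[where f = "\<lambda>i. \<Sum>j<dim_col A. (A $$ (i,j))\<^sup>2"])
      (auto intro: sum_nonneg)
  finally show ?thesis by (simp add: frob_norm_def real_le_rsqrt)
qed

text \<open>The 1-norm; it serves only in the remainder estimates, where its crude submultiplicativity
  in terms of a bound on the matrix entries is enough.\<close>

definition norm1 :: "real vec \<Rightarrow> real" where
  "norm1 v = (\<Sum>i<dim_vec v. \<bar>v $ i\<bar>)"

lemma norm1_nonneg: "norm1 v \<ge> 0"
  by (simp add: norm1_def sum_nonneg)

lemma abs_index_le_norm1: "i < dim_vec v \<Longrightarrow> \<bar>v $ i\<bar> \<le> norm1 v"
  unfolding norm1_def by (rule member_le_sum[where f = "\<lambda>i. \<bar>v $ i\<bar>"]) auto

lemma norm1_le_bound: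
  fixes c :: real
  shows "(\<And>i. i < dim_vec v \<Longrightarrow> \<bar>v $ i\<bar> \<le> c) \<Longrightarrow> norm1 v \<le> dim_vec v * c"
  unfolding norm1_def using sum_bounded_above[of "{..<dim_vec v}" "\<lambda>i. \<bar>v $ i\<bar>" c] by auto

lemma norm1_add: "dim_vec v = dim_vec w \<Longrightarrow> norm1 (v + w) \<le> norm1 v + norm1 w"
  unfolding norm1_def by (simp add: sum.distrib[symmetric] sum_mono)

lemma norm1_diff: "dim_vec v = dim_vec w \<Longrightarrow> norm1 (v - w) \<le> norm1 v + norm1 w"
  unfolding norm1_def by (simp add: sum.distrib[symmetric] sum_mono)

lemma norm1_uminus: "norm1 (- v) = norm1 v"
  by (simp add: norm1_def)

lemma norm1_mult_mat_vec_le: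
  assumes "A \<in> carrier_mat r c" "v \<in> carrier_vec c"
    and "\<And>i j. i < r \<Longrightarrow> j < c \<Longrightarrow> \<bar>A $$ (i,j)\<bar> \<le> \<mu>"
  shows "norm1 (A *\<^sub>v v) \<le> r * \<mu> * norm1 v"
proof -
  have "norm1 (A *\<^sub>v v) \<le> dim_vec (A *\<^sub>v v) * (\<mu> * norm1 v)"
  proof (rule norm1_le_bound)
    fix i assume "i < dim_vec (A *\<^sub>v v)"
    then have i: "i < r" using assms by auto
    have "\<bar>(A *\<^sub>v v) $ i\<bar> = \<bar>\<Sum>j<c. A $$ (i,j) * v $ j\<bar>"
      using i assms by (subst index_mult_mat_vec_sum) auto
    also have "\<dots> \<le> (\<Sum>j<c. \<bar>A $$ (i,j) * v $ j\<bar>)" by (rule sum_abs)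
    also have "\<dots> \<le> (\<Sum>j<c. \<mu> * \<bar>v $ j\<bar>)"
      using i assms(3) by (intro sum_mono) (simp add: abs_mult mult_right_mono)
    finally show "\<bar>(A *\<^sub>v v) $ i\<bar> \<le> \<mu> * norm1 v"
      using assms by (simp add: norm1_def sum_distrib_left)
  qed
  then show ?thesis using assms by (simp add: mult.assoc)
qed

lemma norm2_mult_mat_vec_le:
  assumes "dim_vec v = dim_col A"
  shows "norm2 (A *\<^sub>v v) \<le> frob_norm A * norm2 v"
proof -
  have "(norm2 (A *\<^sub>v v))\<^sup>2 \<le> (\<Sum>i<dim_row A. (\<Sum>j<dim_col A. (A $$ (i,j))\<^sup>2) * (norm2 v)\<^sup>2)"
  proof -
    have "((A *\<^sub>v v) $ i)\<^sup>2 \<le> (\<Sum>j<dim_col A. (A $$ (i,j))\<^sup>2) * (norm2 v)\<^sup>2"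
      if "i < dim_row A" for i
    proof -
      have "\<bar>(A *\<^sub>v v) $ i\<bar> \<le> (\<Sum>j<dim_col A. \<bar>A $$ (i,j)\<bar> * \<bar>v $ j\<bar>)"
        unfolding index_mult_mat_vec_sum[OF that assms] by (simp add: abs_mult[symmetric])
      also have "\<dots> \<le> L2_set (\<lambda>j. A $$ (i,j)) {..<dim_col A} * norm2 v"
        using L2_set_mult_ineq[of "\<lambda>j. A $$ (i,j)" "($) v"] assms by (simp add: norm2_L2_set)
      finally have "\<bar>(A *\<^sub>v v) $ i\<bar>\<^sup>2 \<le> (L2_set (\<lambda>j. A $$ (i,j)) {..<dim_col A} * norm2 v)\<^sup>2"
        by (intro power_mono) auto
      then show ?thesis by (simp add: power_mult_distrib L2_set_def sum_nonneg)
    qed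
    then show ?thesis
      by (subst norm2_def) (auto simp: sum_nonneg intro!: sum_mono)
  qed
  also have "\<dots> = (frob_norm A * norm2 v)\<^sup>2"
    by (simp add: power_mult_distrib frob_norm_sq sum_distrib_right)
  finally show ?thesis
    by (rule power2_le_imp_le) (simp add: frob_norm_nonneg norm2_nonneg)
qed

lemma spectral_norm_ge_unit:
  assumes "v \<in> carrier_vec (dim_col A)" "norm2 v \<le> 1"
  shows "norm2 (A *\<^sub>v v) \<le> spectral_norm A"
proof -
  have "norm2 (A *\<^sub>v v) \<le> frob_norm A * 1" if "v \<in> carrier_vec (dim_col A)" "norm2 v \<le> 1" for v
  proof -
    have "norm2 (A *\<^sub>v v) \<le> frob_norm A * norm2 v" using that by (auto intro: norm2_mult_mat_vec_le)
    then show ?thesis using frob_norm_nonneg[of A] that(2) by (meson mult_left_mono order_trans)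
  qed
  then have "bdd_above ((\<lambda>v. norm2 (A *\<^sub>v v)) ` {v \<in> carrier_vec (dim_col A). norm2 v \<le> 1})"
    by (intro bdd_aboveI2) auto
  then show ?thesis
    unfolding spectral_norm_def using assms by (intro cSUP_upper) auto
qed

lemma spectral_norm_nonneg: "spectral_norm A \<ge> 0"
  using spectral_norm_ge_unit[of "0\<^sub>v (dim_col A)" A] norm2_nonneg norm2_eq_0_iff[of "0\<^sub>v (dim_col A)" "dim_col A"]
  by (metis order_trans zero_carrier_vec zero_le_one)

lemma norm2_mult_le_spectral_norm:
  assumes "v \<in> carrier_vec (dim_col A)"
  shows "norm2 (A *\<^sub>v v) \<le> spectral_norm A * norm2 v"
proof (cases "norm2 v = 0")
  case True
  then have "v = 0\<^sub>v (dim_col A)" using assms norm2_eq_0_iff by blast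
  then have "A *\<^sub>v v = 0\<^sub>v (dim_row A)" by auto
  then show ?thesis using True norm2_eq_0_iff[of "A *\<^sub>v v" "dim_row A"] by simp
next
  case False
  let ?u = "(1 / norm2 v) \<cdot>\<^sub>v v"
  have "norm2 (A *\<^sub>v ?u) \<le> spectral_norm A"
    using False assms by (intro spectral_norm_ge_unit) (simp_all add: norm2_smult norm2_nonneg)
  moreover have "A *\<^sub>v ?u = (1 / norm2 v) \<cdot>\<^sub>v (A *\<^sub>v v)"
    using assms by (intro mult_mat_vec) auto
  ultimately show ?thesis
    using False norm2_nonneg[of v] by (simp add: norm2_smult field_simps)
qed

lemma spectral_norm_nearly_attained:
  assumes "\<epsilon> > 0"
  obtains v where "v \<in> carrier_vec (dim_col A)" "norm2 v \<le> 1" "spectral_norm A - \<epsilon> \<le> norm2 (A *\<^sub>v v)"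
proof -
  let ?U = "{v \<in> carrier_vec (dim_col A). norm2 v \<le> 1}"
  have ne: "?U \<noteq> {}"
    using norm2_eq_0_iff[of "0\<^sub>v (dim_col A)" "dim_col A"] by (auto intro!: exI[of _ "0\<^sub>v (dim_col A)"])
  have "\<exists>v\<in>?U. spectral_norm A - \<epsilon> \<le> norm2 (A *\<^sub>v v)"
  proof (rule ccontr)
    assume "\<not> ?thesis"
    then have "spectral_norm A \<le> spectral_norm A - \<epsilon>"
      unfolding spectral_norm_def using ne by (intro cSUP_least) auto
    then show False using assms by simp
  qed
  then show ?thesis using that by auto
qed

text \<open>The maximum norm with weights \<open>\<omega>\<close>: weights 1 give the norm of the mixed condition number,
  weights \<open>1 / \<bar>c\<^sub>i\<bar>\<close>, with \<open>c = L z\<close>, that of the componentwise one.\<close>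

definition max_norm :: "(nat \<Rightarrow> real) \<Rightarrow> real vec \<Rightarrow> real" where
  "max_norm \<omega> v = Max ((\<lambda>i. \<omega> i * \<bar>v $ i\<bar>) ` {..<dim_vec v})"

lemma norm_inf_eq_max_norm: "norm_inf = max_norm (\<lambda>_. 1)"
  by (simp add: norm_inf_def max_norm_def fun_eq_iff)

lemma max_norm_le_iff:
  "0 < dim_vec v \<Longrightarrow> max_norm \<omega> v \<le> c \<longleftrightarrow> (\<forall>i<dim_vec v. \<omega> i * \<bar>v $ i\<bar> \<le> c)"
  unfolding max_norm_def by (subst Max_le_iff) auto

lemma max_norm_ge: "i < dim_vec v \<Longrightarrow> \<omega> i * \<bar>v $ i\<bar> \<le> max_norm \<omega> v"
  unfolding max_norm_def by (intro Max_ge) auto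

lemma max_norm_attained:
  assumes "0 < dim_vec v"
  obtains i where "i < dim_vec v" "max_norm \<omega> v = \<omega> i * \<bar>v $ i\<bar>"
proof -
  have "max_norm \<omega> v \<in> (\<lambda>i. \<omega> i * \<bar>v $ i\<bar>) ` {..<dim_vec v}"
    unfolding max_norm_def using assms by (intro Max_in) auto
  then show ?thesis using that by auto
qed

lemma max_norm_le_add_entries:
  assumes "dim_vec v = k" "dim_vec w = k" "0 < k" "\<And>i. i < k \<Longrightarrow> 0 \<le> \<omega> i \<and> \<omega> i \<le> \<kappa>"
    and e: "\<And>i. i < k \<Longrightarrow> \<bar>v $ i - w $ i\<bar> \<le> e"
  shows "max_norm \<omega> v \<le> max_norm \<omega> w + \<kappa> * e"
proof -
  have "\<omega> i * \<bar>v $ i\<bar> \<le> max_norm \<omega> w + \<kappa> * e" if i: "i < k" for i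
  proof -
    have "\<bar>v $ i\<bar> \<le> \<bar>w $ i\<bar> + e" using e[OF i] by linarith
    then have "\<omega> i * \<bar>v $ i\<bar> \<le> \<omega> i * (\<bar>w $ i\<bar> + e)" using i assms by (intro mult_left_mono) auto
    also have "\<dots> = \<omega> i * \<bar>w $ i\<bar> + \<omega> i * e" by (rule distrib_left)
    also have "\<omega> i * e \<le> \<kappa> * e" using i assms(4) e[OF i] by (intro mult_right_mono) auto
    also have "\<omega> i * \<bar>w $ i\<bar> \<le> max_norm \<omega> w" using i assms by (intro max_norm_ge) auto
    finally show ?thesis by simp
  qed
  then show ?thesis using assms by (subst max_norm_le_iff) auto
qed

section \<open>First-order perturbation of a linear system\<close>

lemma mat_inv_inverse:
  assumes "A \<in> carrier_mat n n" "invertible_mat A"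
  shows "mat_inv A \<in> carrier_mat n n" "A * mat_inv A = 1\<^sub>m n" "mat_inv A * A = 1\<^sub>m n"
proof -
  obtain B where B: "A * B = 1\<^sub>m n" "B * A = 1\<^sub>m (dim_row B)"
    using assms unfolding invertible_mat_def inverts_mat_def by auto
  then have "dim_row B = n" "dim_col B = n"
    using assms(1) by (metis carrier_matD(2) index_mult_mat(3) index_one_mat(3))+
  then have "A \<in> Units (ring_mat TYPE(real) n ())"
    using assms B by (auto simp: Units_def ring_mat_def intro!: bexI[of _ B])
  then obtain C where "mat_inverse A = Some C"
    using mat_inverse(1)[OF assms(1), of "()"] by blast
  with mat_inverse(2)[OF assms(1) this]
  show "mat_inv A \<in> carrier_mat n n" "A * mat_inv A = 1\<^sub>m n" "mat_inv A * A = 1\<^sub>m n"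
    by (auto simp: mat_inv_def)
qed

lemma unique_solution_if_det_nonzero:
  fixes A :: "real mat"
  assumes A: "A \<in> carrier_mat n n" "det A \<noteq> 0" and b: "b \<in> carrier_vec n"
  obtains z where "z \<in> carrier_vec n" "unique_solution A b z"
proof -
  obtain B where B: "B \<in> carrier_mat n n" "B * A = 1\<^sub>m n" "A * B = 1\<^sub>m n"
    using det_non_zero_imp_unit[OF A(1,2), of "()"] by (auto simp: Units_def ring_mat_def)
  have "A *\<^sub>v (B *\<^sub>v b) = (A * B) *\<^sub>v b"
    by (rule assoc_mult_mat_vec[OF A(1) B(1) b, symmetric])
  then have "A *\<^sub>v (B *\<^sub>v b) = b" using B b by simp
  moreover have "z' = B *\<^sub>v b" if "z' \<in> carrier_vec n" "A *\<^sub>v z' = b" for z'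
  proof -
    have "B *\<^sub>v b = (B * A) *\<^sub>v z'" using that assoc_mult_mat_vec[OF B(1) A(1), of z'] by simp
    then show ?thesis using B that by simp
  qed
  ultimately have "unique_solution A b (B *\<^sub>v b)"
    using A B b by (simp add: unique_solution_def)
  then show ?thesis using that B b by (meson mult_mat_vec_carrier)
qed

text \<open>If the data of \<open>M z = b\<close> change by at most \<open>c \<eta>\<close> in every entry and \<open>\<eta>\<close> is small, then the
  perturbed system stays uniquely solvable, and its solution changes by \<open>M\<^sup>-\<^sup>1 (e - E z)\<close> up to a
  remainder that is quadratic in \<open>\<eta>\<close>. Indeed \<open>dz = M\<^sup>-\<^sup>1 (e - E z) - M\<^sup>-\<^sup>1 E dz\<close>, where \<open>M\<^sup>-\<^sup>1 E\<close> is a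
  contraction.\<close>

lemma perturbed_system:
  assumes M: "M \<in> carrier_mat N N" and Mi: "Mi \<in> carrier_mat N N" and inv: "Mi * M = 1\<^sub>m N"
    and z: "z \<in> carrier_vec N" and b: "b \<in> carrier_vec N" and Mz: "M *\<^sub>v z = b" and c: "c \<ge> 0"
  obtains \<delta> C where "\<delta> > 0" "C \<ge> 0"
    "\<And>\<eta> E e. 0 < \<eta> \<Longrightarrow> \<eta> < \<delta> \<Longrightarrow> E \<in> carrier_mat N N \<Longrightarrow> e \<in> carrier_vec N \<Longrightarrow>
       (\<And>i j. i < N \<Longrightarrow> j < N \<Longrightarrow> \<bar>E $$ (i,j)\<bar> \<le> c * \<eta>) \<Longrightarrow>
       \<exists>dz\<in>carrier_vec N. unique_solution (M + E) (b + e) (z + dz)"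
    "\<And>\<eta> E e dz. 0 < \<eta> \<Longrightarrow> \<eta> < \<delta> \<Longrightarrow> E \<in> carrier_mat N N \<Longrightarrow> e \<in> carrier_vec N \<Longrightarrow>
       (\<And>i j. i < N \<Longrightarrow> j < N \<Longrightarrow> \<bar>E $$ (i,j)\<bar> \<le> c * \<eta>) \<Longrightarrow> (\<And>i. i < N \<Longrightarrow> \<bar>e $ i\<bar> \<le> c * \<eta>) \<Longrightarrow>
       dz \<in> carrier_vec N \<Longrightarrow> (M + E) *\<^sub>v (z + dz) = b + e \<Longrightarrow>
       norm1 (dz - Mi *\<^sub>v (e - E *\<^sub>v z)) \<le> C * \<eta>\<^sup>2"
proof -
  define \<mu> where "\<mu> = frob_norm Mi"
  define \<kappa> where "\<kappa> = N * \<mu> * (N * c)"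
  define C1 where "C1 = \<kappa> * (1 + norm1 z)"
  \<comment> \<open>With this \<open>\<delta>\<close> the map \<open>M\<^sup>-\<^sup>1 E\<close> at most halves the 1-norm.\<close>
  define \<delta> where "\<delta> = 1 / (2 * (\<kappa> + 1))"
  have \<mu>: "\<mu> \<ge> 0" by (simp add: \<mu>_def frob_norm_nonneg)
  then have \<kappa>: "\<kappa> \<ge> 0" using c by (simp add: \<kappa>_def)
  have \<delta>: "\<delta> > 0" using \<kappa> by (simp add: \<delta>_def)
  have C1: "C1 \<ge> 0" using \<kappa> norm1_nonneg[of z] by (simp add: C1_def)
  have half: "\<kappa> * \<eta> \<le> 1/2" if "0 < \<eta>" "\<eta> < \<delta>" for \<eta>
    using that \<kappa> by (simp add: \<delta>_def field_simps)
  have Mi_le: "norm1 (Mi *\<^sub>v v) \<le> N * \<mu> * norm1 v" if "v \<in> carrier_vec N" for v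
    using Mi that abs_entry_le_frob_norm[of _ Mi] by (intro norm1_mult_mat_vec_le) (auto simp: \<mu>_def)
  have MiE: "norm1 (Mi *\<^sub>v (E *\<^sub>v v)) \<le> \<kappa> * \<eta> * norm1 v"
    if "E \<in> carrier_mat N N" "v \<in> carrier_vec N"
      and "\<And>i j. i < N \<Longrightarrow> j < N \<Longrightarrow> \<bar>E $$ (i,j)\<bar> \<le> c * \<eta>" for E v \<eta>
  proof -
    have "norm1 (E *\<^sub>v v) \<le> N * (c * \<eta>) * norm1 v" using that by (intro norm1_mult_mat_vec_le) auto
    then have "N * \<mu> * norm1 (E *\<^sub>v v) \<le> N * \<mu> * (N * (c * \<eta>) * norm1 v)"
      using \<mu> by (intro mult_left_mono) auto
    then show ?thesis
      using Mi_le[of "E *\<^sub>v v"] that by (simp add: \<kappa>_def algebra_simps)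
  qed
  have ex: "\<exists>dz\<in>carrier_vec N. unique_solution (M + E) (b + e) (z + dz)"
    if \<eta>: "0 < \<eta>" "\<eta> < \<delta>" and E: "E \<in> carrier_mat N N" and e: "e \<in> carrier_vec N"
      and E_le: "\<And>i j. i < N \<Longrightarrow> j < N \<Longrightarrow> \<bar>E $$ (i,j)\<bar> \<le> c * \<eta>" for \<eta> E e
  proof -
    have "v = 0\<^sub>v N" if v: "v \<in> carrier_vec N" "(M + E) *\<^sub>v v = 0\<^sub>v N" for v
    proof -
      have "Mi *\<^sub>v (M *\<^sub>v v + E *\<^sub>v v) = Mi *\<^sub>v 0\<^sub>v N"
        using v add_mult_distrib_mat_vec[OF M E v(1)] by simp
      also have "Mi *\<^sub>v (M *\<^sub>v v + E *\<^sub>v v) = v + Mi *\<^sub>v (E *\<^sub>v v)"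
        using mult_add_distrib_mat_vec[OF Mi, of "M *\<^sub>v v" "E *\<^sub>v v"]
          assoc_mult_mat_vec[OF Mi M v(1)] inv M E v by simp
      finally have eq: "v + Mi *\<^sub>v (E *\<^sub>v v) = 0\<^sub>v N" using Mi by auto
      have "v = - (Mi *\<^sub>v (E *\<^sub>v v))"
      proof (rule eq_vecI)
        fix i assume "i < dim_vec (- (Mi *\<^sub>v (E *\<^sub>v v)))"
        then show "v $ i = (- (Mi *\<^sub>v (E *\<^sub>v v))) $ i"
          using arg_cong[OF eq, of "\<lambda>w. w $ i"] Mi v by simp
      qed (use Mi v in auto)
      then have "norm1 v = norm1 (Mi *\<^sub>v (E *\<^sub>v v))" by (metis norm1_uminus)
      also have "\<dots> \<le> \<kappa> * \<eta> * norm1 v" using E v E_le by (intro MiE) auto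
      also have "\<dots> \<le> 1/2 * norm1 v" using half[OF \<eta>] norm1_nonneg by (intro mult_right_mono) auto
      finally have "norm1 v = 0" using norm1_nonneg[of v] by linarith
      then show "v = 0\<^sub>v N" using v abs_index_le_norm1[of _ v] by (intro eq_vecI) auto
    qed
    then have "det (M + E) \<noteq> 0"
      using M E det_0_iff_vec_prod_zero_field[of "M + E" N] by auto
    then obtain w where w: "w \<in> carrier_vec N" "unique_solution (M + E) (b + e) w"
      using unique_solution_if_det_nonzero[of "M + E" N "b + e"] M E b e by auto
    have "z + (w - z) = w" using w z by (intro eq_vecI) auto
    with w z show ?thesis by (intro bexI[of _ "w - z"]) auto
  qed
  have bound: "norm1 (dz - Mi *\<^sub>v (e - E *\<^sub>v z)) \<le> (2 * \<kappa> * C1) * \<eta>\<^sup>2"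
    if \<eta>: "0 < \<eta>" "\<eta> < \<delta>" and E: "E \<in> carrier_mat N N" and e: "e \<in> carrier_vec N"
      and E_le: "\<And>i j. i < N \<Longrightarrow> j < N \<Longrightarrow> \<bar>E $$ (i,j)\<bar> \<le> c * \<eta>"
      and e_le: "\<And>i. i < N \<Longrightarrow> \<bar>e $ i\<bar> \<le> c * \<eta>"
      and dz: "dz \<in> carrier_vec N" and eq: "(M + E) *\<^sub>v (z + dz) = b + e" for \<eta> E e dz
  proof -
    let ?r = "Mi *\<^sub>v (e - E *\<^sub>v z)"
    let ?q = "Mi *\<^sub>v (E *\<^sub>v dz)"
    let ?p = "Mi *\<^sub>v (E *\<^sub>v z)"
    have zdz: "z + dz \<in> carrier_vec N" using z dz by simp
    have Ez: "E *\<^sub>v z \<in> carrier_vec N" "E *\<^sub>v dz \<in> carrier_vec N" "M *\<^sub>v (z + dz) \<in> carrier_vec N"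
      using E M z dz by auto
    have "Mi *\<^sub>v ((M + E) *\<^sub>v (z + dz)) = (Mi * M) *\<^sub>v (z + dz) + (?p + ?q)"
      using add_mult_distrib_mat_vec[OF M E zdz] assoc_mult_mat_vec[OF Mi M zdz]
        mult_add_distrib_mat_vec[OF Mi, of "M *\<^sub>v (z + dz)" "E *\<^sub>v z + E *\<^sub>v dz"]
        mult_add_distrib_mat_vec[OF Mi Ez(1,2)] mult_add_distrib_mat_vec[OF E z dz] Ez
      by simp
    moreover have "Mi *\<^sub>v (b + e) = z + Mi *\<^sub>v e"
      using mult_add_distrib_mat_vec[OF Mi b e] assoc_mult_mat_vec[OF Mi M z] Mz inv z by simp
    ultimately have sum: "(z + dz) + (?p + ?q) = z + Mi *\<^sub>v e"
      using eq inv zdz by simp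
    have "?r = Mi *\<^sub>v e - ?p" by (rule mult_minus_distrib_mat_vec[OF Mi e Ez(1)])
    then have rem: "dz - ?r = - ?q"
    proof (intro eq_vecI)
      fix i assume "i < dim_vec (- ?q)"
      then show "(dz - ?r) $ i = (- ?q) $ i"
        using arg_cong[OF sum, of "\<lambda>w. w $ i"] \<open>?r = Mi *\<^sub>v e - ?p\<close> Mi E z dz e
        by (simp del: index_mult_mat_vec)
    qed (use Mi dz in auto)
    have q: "norm1 ?q \<le> \<kappa> * \<eta> * norm1 dz" using E dz E_le by (intro MiE) auto
    have "norm1 (e - E *\<^sub>v z) \<le> norm1 e + norm1 (E *\<^sub>v z)" using e E by (intro norm1_diff) auto
    also have "norm1 e \<le> N * (c * \<eta>)" using norm1_le_bound[of e "c * \<eta>"] e e_le by auto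
    also have "norm1 (E *\<^sub>v z) \<le> N * (c * \<eta>) * norm1 z"
      using E z E_le by (intro norm1_mult_mat_vec_le) auto
    finally have "N * \<mu> * norm1 (e - E *\<^sub>v z) \<le> N * \<mu> * (N * (c * \<eta>) + N * (c * \<eta>) * norm1 z)"
      using \<mu> by (intro mult_left_mono) auto
    then have r: "norm1 ?r \<le> C1 * \<eta>"
      using Mi_le[of "e - E *\<^sub>v z"] E e z by (simp add: C1_def \<kappa>_def algebra_simps)
    have "dz = (dz - ?r) + ?r" using dz Mi by (intro eq_vecI) auto
    then have "norm1 dz \<le> norm1 (dz - ?r) + norm1 ?r"
      using norm1_add[of "dz - ?r" ?r] by (metis index_minus_vec(2))
    also have "\<dots> \<le> 1/2 * norm1 dz + C1 * \<eta>"
      unfolding rem norm1_uminus using q r mult_right_mono[OF half[OF \<eta>] norm1_nonneg[of dz]] by linarith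
    finally have "norm1 dz \<le> 2 * C1 * \<eta>" by simp
    then have "\<kappa> * \<eta> * norm1 dz \<le> \<kappa> * \<eta> * (2 * C1 * \<eta>)"
      using \<kappa> \<eta> by (intro mult_left_mono) auto
    then show ?thesis
      unfolding rem norm1_uminus using q by (simp add: power2_eq_square algebra_simps)
  qed
  show thesis
  proof (rule that[OF \<delta>])
    show "0 \<le> 2 * \<kappa> * C1" using \<kappa> C1 by simp
  qed ((erule (1) ex; simp), (erule (1) bound; simp))
qed

section \<open>The limit of a scaled supremum\<close>

lemma scaled_sup_tendsto:
  fixes Q :: "real \<Rightarrow> real set"
  assumes "c > 0" "\<delta> > 0"
    and upper: "\<And>\<eta> a. 0 < \<eta> \<Longrightarrow> \<eta> < \<delta> \<Longrightarrow> a \<in> Q \<eta> \<Longrightarrow> a \<le> \<eta> * V + C * \<eta>\<^sup>2"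
    and lower: "\<And>\<eta>. 0 < \<eta> \<Longrightarrow> \<eta> < \<delta> \<Longrightarrow> \<exists>a\<in>Q \<eta>. \<eta> * V - C * \<eta>\<^sup>2 \<le> a"
  shows "((\<lambda>\<eta>. Sup ((\<lambda>a. ereal (a / (\<eta> * c))) ` Q \<eta>)) \<longlongrightarrow> ereal (V / c)) (at_right 0)"
proof (rule tendsto_sandwich)
  have small: "eventually (\<lambda>\<eta>::real. 0 < \<eta> \<and> \<eta> < \<delta>) (at_right 0)"
    using \<open>\<delta> > 0\<close> by (auto simp: eventually_at_right)
  show "eventually (\<lambda>\<eta>. ereal ((V - C * \<eta>) / c) \<le> Sup ((\<lambda>a. ereal (a / (\<eta> * c))) ` Q \<eta>)) (at_right 0)"
    using small
  proof eventually_elim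
    case (elim \<eta>)
    then obtain a where a: "a \<in> Q \<eta>" "\<eta> * V - C * \<eta>\<^sup>2 \<le> a" using lower by auto
    then have "(V - C * \<eta>) * \<eta> \<le> a" by (simp add: algebra_simps power2_eq_square)
    then have "V - C * \<eta> \<le> a / \<eta>" using elim by (simp add: pos_le_divide_eq)
    then have "(V - C * \<eta>) / c \<le> a / \<eta> / c" using \<open>c > 0\<close> by (intro divide_right_mono) auto
    then have "(V - C * \<eta>) / c \<le> a / (\<eta> * c)" by simp
    then show ?case using a by (intro SUP_upper2[of a]) auto
  qed
  show "eventually (\<lambda>\<eta>. Sup ((\<lambda>a. ereal (a / (\<eta> * c))) ` Q \<eta>) \<le> ereal ((V + C * \<eta>) / c)) (at_right 0)"
    using small
  proof eventually_elim
    case (elim \<eta>)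
    have "a / (\<eta> * c) \<le> (V + C * \<eta>) / c" if "a \<in> Q \<eta>" for a
    proof -
      have "a \<le> (V + C * \<eta>) * \<eta>"
        using upper[OF _ _ that] elim by (simp add: algebra_simps power2_eq_square)
      then have "a / \<eta> \<le> V + C * \<eta>" using elim by (simp add: pos_divide_le_eq)
      then have "a / \<eta> / c \<le> (V + C * \<eta>) / c" using \<open>c > 0\<close> by (intro divide_right_mono) auto
      then show ?thesis by simp
    qed
    then show ?case by (intro SUP_least) auto
  qed
  show "((\<lambda>\<eta>. ereal ((V - C * \<eta>) / c)) \<longlongrightarrow> ereal (V / c)) (at_right 0)"
    using \<open>c > 0\<close> by (auto intro!: tendsto_eq_intros)
  show "((\<lambda>\<eta>. ereal ((V + C * \<eta>) / c)) \<longlongrightarrow> ereal (V / c)) (at_right 0)"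
    using \<open>c > 0\<close> by (auto intro!: tendsto_eq_intros)
qed

section \<open>Generators of the structured matrices\<close>

lemma carrier_sym: "A \<in> sym_mats m \<Longrightarrow> A \<in> carrier_mat m m"
  by (simp add: sym_mats_def)

lemma carrier_toeplitz: "T \<in> toeplitz_mats n m \<Longrightarrow> T \<in> carrier_mat n m"
  by (simp add: toeplitz_mats_def)

lemma vec_sym_carrier: "A \<in> carrier_mat m m \<Longrightarrow> vec_sym A \<in> carrier_vec (m * (m + 1) div 2)"
  by (intro carrier_vecI) (simp add: vec_sym_def length_sym_idx)

lemma vec_sym_index:
  "A \<in> carrier_mat m m \<Longrightarrow> p < length (sym_idx m) \<Longrightarrow> vec_sym A $ p = A $$ (sym_idx m ! p)"
  by (simp add: vec_sym_def vec_of_list_index case_prod_beta)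

lemma vec_sym_entry:
  assumes "p < m * (m + 1) div 2"
  shows "\<exists>i<m. \<exists>j<m. \<forall>A\<in>carrier_mat m m. vec_sym A $ p = A $$ (i,j)"
proof -
  obtain i j where ij: "sym_idx m ! p = (i,j)" by force
  then have "(i,j) \<in> set (sym_idx m)" using assms by (metis length_sym_idx nth_mem)
  then have "i < m" "j < m" by (auto simp: set_sym_idx)
  then show ?thesis using ij assms by (metis length_sym_idx vec_sym_index)
qed

lemma sym_entry_vec_sym:
  assumes "i < m" "j < m"
  shows "\<exists>p<m * (m + 1) div 2. \<forall>A\<in>sym_mats m. A $$ (i,j) = vec_sym A $ p"
proof -
  have *: "\<exists>p<m * (m + 1) div 2. \<forall>A\<in>carrier_mat m m. A $$ (i,j) = vec_sym A $ p"
    if "i \<le> j" "j < m" for i j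
  proof -
    have "(i,j) \<in> set (sym_idx m)" using that by (simp add: set_sym_idx)
    then obtain p where "p < length (sym_idx m)" "sym_idx m ! p = (i,j)" by (metis in_set_conv_nth)
    then show ?thesis by (metis length_sym_idx vec_sym_index)
  qed
  have sym: "A $$ (i,j) = A $$ (j,i)" if "A \<in> sym_mats m" for A
    using that assms unfolding sym_mats_def
    by (metis (mono_tags, lifting) carrier_matD index_transpose_mat(1) mem_Collect_eq)
  show ?thesis
  proof (cases "i \<le> j")
    case True
    then show ?thesis using *[of i j] assms carrier_sym by blast
  next
    case False
    then show ?thesis using *[of j i] assms carrier_sym sym by (metis nat_le_linear)
  qed
qed

lemma vec_sym_surj:
  assumes v: "v \<in> carrier_vec (m * (m + 1) div 2)"
  obtains A where "A \<in> sym_mats m" "vec_sym A = v"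
proof
  let ?A = "mat m m (\<lambda>(i,j). v $ (sym_off m (min i j) + (max i j - min i j)))"
  show "?A \<in> sym_mats m"
    by (auto simp: sym_mats_def min.commute max.commute intro!: eq_matI)
  show "vec_sym ?A = v"
  proof (rule eq_vecI)
    show "dim_vec (vec_sym ?A) = dim_vec v" using v vec_sym_carrier[of ?A m] by auto
    fix p assume "p < dim_vec v"
    then have p: "p < length (sym_idx m)" using v by (simp add: length_sym_idx)
    obtain i j where ij: "sym_idx m ! p = (i,j)" by force
    then have "(i,j) \<in> set (sym_idx m)" using p by (metis nth_mem)
    then have le: "i \<le> j" "j < m" by (auto simp: set_sym_idx)
    then have "sym_off m i + (j - i) = p"
      using nth_sym_idx[of i m "j - i"] ij p distinct_sym_idx[of m]
      by (metis diff_less_mono le_add_diff_inverse nth_eq_iff_index_eq order.strict_trans1)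
    then show "vec_sym ?A $ p = v $ p"
      using le by (simp add: vec_sym_index[OF _ p] ij)
  qed
qed

lemma vec_toeplitz_carrier:
  "T \<in> carrier_mat n m \<Longrightarrow> n > 0 \<Longrightarrow> m > 0 \<Longrightarrow> vec_toeplitz T \<in> carrier_vec (m + n - 1)"
  by (intro carrier_vecI) (simp add: vec_toeplitz_def)

text \<open>The generators run up the first column and then along the first row; truncated subtraction
  yields the index 0 on the respective other side.\<close>

lemma vec_toeplitz_index:
  assumes "T \<in> carrier_mat n m" "n > 0" "m > 0" "p < m + n - 1"
  shows "vec_toeplitz T $ p = T $$ (n - 1 - p, p + 1 - n)"
  using assms by (auto simp: vec_toeplitz_def vec_of_list_index toeplitz_gen_def nat_diff_distrib
      intro!: arg_cong[where f = "\<lambda>k. T $$ k"])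

lemma vec_toeplitz_entry:
  assumes "n > 0" "m > 0" "p < m + n - 1"
  shows "\<exists>i<n. \<exists>j<m. \<forall>T\<in>carrier_mat n m. vec_toeplitz T $ p = T $$ (i,j)"
  using assms vec_toeplitz_index[of _ n m p]
  by (intro exI[of _ "n - 1 - p"] conjI exI[of _ "p + 1 - n"]) auto

lemma toeplitz_index:
  assumes "T \<in> toeplitz_mats n m" "i < n" "j < m"
  shows "T $$ (i,j) = vec_toeplitz T $ (j + n - 1 - i)"
proof -
  obtain t where T: "T \<in> carrier_mat n m"
    and t: "\<And>i j. i < n \<Longrightarrow> j < m \<Longrightarrow> T $$ (i,j) = t (int j - int i)"
    using assms(1) unfolding toeplitz_mats_def by auto
  have "vec_toeplitz T $ (j + n - 1 - i) = T $$ (n - 1 - (j + n - 1 - i), j + n - 1 - i + 1 - n)"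
    using assms by (intro vec_toeplitz_index[OF T]) auto
  also have "\<dots> = t (int (j + n - 1 - i + 1 - n) - int (n - 1 - (j + n - 1 - i)))"
    using assms by (intro t) auto
  also have "int (j + n - 1 - i + 1 - n) - int (n - 1 - (j + n - 1 - i)) = int j - int i"
    using assms by auto
  finally show ?thesis using t assms by simp
qed

lemma vec_toeplitz_surj:
  assumes v: "v \<in> carrier_vec (m + n - 1)" and nm: "n > 0" "m > 0"
  obtains T where "T \<in> toeplitz_mats n m" "vec_toeplitz T = v"
proof
  let ?T = "mat n m (\<lambda>(i,j). v $ (j + n - 1 - i))"
  have "\<forall>i<n. \<forall>j<m. ?T $$ (i,j) = v $ nat (int j - int i + int n - 1)"
    by (auto simp: nat_diff_distrib intro!: arg_cong[where f = "\<lambda>k. v $ k"])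
  then show "?T \<in> toeplitz_mats n m"
    unfolding toeplitz_mats_def
    by (intro CollectI conjI exI[of _ "\<lambda>l. v $ nat (l + int n - 1)"]) auto
  show "vec_toeplitz ?T = v"
  proof (rule eq_vecI)
    show "dim_vec (vec_toeplitz ?T) = dim_vec v" using v nm vec_toeplitz_carrier[of ?T n m] by auto
    fix p assume p: "p < dim_vec v"
    then have "vec_toeplitz ?T $ p = ?T $$ (n - 1 - p, p + 1 - n)"
      using v nm by (intro vec_toeplitz_index) auto
    also have "\<dots> = v $ p" using p v nm by (auto intro!: arg_cong[where f = "\<lambda>k. v $ k"])
    finally show "vec_toeplitz ?T $ p = v $ p" .
  qed
qed

lemma vectorize_carrier: "A \<in> carrier_mat r c \<Longrightarrow> vectorize A \<in> carrier_vec (r * c)"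
  by (intro carrier_vecI) (simp add: vectorize_def)

lemma vectorize_index:
  "A \<in> carrier_mat r c \<Longrightarrow> k < r * c \<Longrightarrow> vectorize A $ k = A $$ (k mod r, k div r)"
  by (simp add: vectorize_def)

lemma div_mod_less:
  assumes "k < r * (c::nat)" shows "k mod r < r" "k div r < c"
proof -
  have "r > 0" using assms by (cases r) auto
  then show "k mod r < r" by simp
  show "k div r < c" using assms by (simp add: less_mult_imp_div_less mult.commute)
qed

lemma column_major_position:
  assumes "i < r" "j < (c::nat)"
  shows "j * r + i < r * c" "(j * r + i) mod r = i" "(j * r + i) div r = j"
proof -
  have "j * r + i < (j + 1) * r" using assms by simp
  also have "\<dots> \<le> c * r" using assms by (intro mult_right_mono) auto
  finally show "j * r + i < r * c" by (simp add: mult.commute)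
qed (use assms in auto)

lemma entry_vectorize:
  "A \<in> carrier_mat r c \<Longrightarrow> i < r \<Longrightarrow> j < c \<Longrightarrow> A $$ (i,j) = vectorize A $ (j * r + i)"
  using column_major_position[of i r j c] by (simp add: vectorize_index)

lemma vectorize_surj:
  assumes v: "v \<in> carrier_vec (r * c)"
  obtains A where "A \<in> carrier_mat r c" "vectorize A = v"
proof
  let ?A = "mat r c (\<lambda>(i,j). v $ (j * r + i))"
  show "?A \<in> carrier_mat r c" by simp
  show "vectorize ?A = v"
    using v div_mod_less[of _ r c] by (intro eq_vecI) (auto simp: vectorize_def)
qed

lemma sum_lessThan_add: "(\<Sum>i<a + b. f i) = (\<Sum>i<a. f i) + (\<Sum>i<b. f (a + i :: nat) :: real)"
  by (induction b) (simp_all add: add.assoc)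

lemma sum_div_mod:
  fixes a b :: nat and F :: "nat \<Rightarrow> nat \<Rightarrow> real"
  shows "(\<Sum>k<a * b. F (k mod a) (k div a)) = (\<Sum>j<b. \<Sum>i<a. F i j)"
proof (induction b)
  case (Suc b)
  have "a * Suc b = a * b + a" by simp
  then have "(\<Sum>k<a * Suc b. F (k mod a) (k div a)) =
      (\<Sum>k<a * b. F (k mod a) (k div a)) + (\<Sum>i<a. F ((a * b + i) mod a) ((a * b + i) div a))"
    by (simp only: sum_lessThan_add)
  also have "(\<Sum>i<a. F ((a * b + i) mod a) ((a * b + i) div a)) = (\<Sum>i<a. F i b)"
    by (rule sum.cong) auto
  finally show ?case using Suc by simp
qed simp

lemma norm2_vectorize: "norm2 (vectorize A) = frob_norm A"
proof -
  have "(\<Sum>k<dim_row A * dim_col A. (A $$ (k mod dim_row A, k div dim_row A))\<^sup>2)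
      = (\<Sum>j<dim_col A. \<Sum>i<dim_row A. (A $$ (i,j))\<^sup>2)"
    by (rule sum_div_mod)
  also have "\<dots> = (\<Sum>i<dim_row A. \<Sum>j<dim_col A. (A $$ (i,j))\<^sup>2)"
    by (rule sum.swap)
  finally show ?thesis by (simp add: norm2_def frob_norm_def vectorize_def)
qed

section \<open>The matrices \<open>\<Phi>\<close>, \<open>\<R>\<close> and the weights\<close>

lemma Phi_sym_carrier: "Phi_sym m \<in> carrier_mat (m * m) (m * (m + 1) div 2)"
  unfolding Phi_sym_def by (rule carrier_matI) (simp_all only: mat_of_cols_carrier length_map length_sym_idx)

lemma Phi_sym_mult:
  assumes A: "A \<in> sym_mats m"
  shows "Phi_sym m *\<^sub>v vec_sym A = vectorize A"
proof (rule eq_vecI)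
  have Ac: "A \<in> carrier_mat m m" using A by (rule carrier_sym)
  show "dim_vec (Phi_sym m *\<^sub>v vec_sym A) = dim_vec (vectorize A)"
    using Ac Phi_sym_carrier[of m] by (auto simp: vectorize_def)
  fix k assume "k < dim_vec (vectorize A)"
  then have k: "k < m * m" using Ac by (auto simp: vectorize_def)
  let ?r = "k mod m" and ?s = "k div m" and ?I = "sym_idx m"
  let ?mn = "(min ?r ?s, max ?r ?s)"
  have rs: "?r < m" "?s < m" using div_mod_less[OF k] .
  have Phi: "Phi_sym m $$ (k,p) = (if ?I ! p = ?mn then 1 else 0)" if p: "p < length ?I" for p
  proof -
    obtain i j where ij: "?I ! p = (i,j)" by force
    then have "(i,j) \<in> set ?I" using p by (metis nth_mem)
    then have "i \<le> j" by (auto simp: set_sym_idx)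
    have "Phi_sym m $$ (k,p) = vectorize (sym_basis m (i,j)) $ k"
      using p k by (simp add: Phi_sym_def mat_of_cols_index ij)
    also have "\<dots> = sym_basis m (i,j) $$ (?r,?s)"
      using k by (intro vectorize_index) (simp_all add: sym_basis_def)
    also have "\<dots> = (if (?r,?s) = (i,j) \<or> (?r,?s) = (j,i) then 1 else 0)"
      using rs by (simp add: sym_basis_def)
    also have "\<dots> = (if ?I ! p = ?mn then 1 else 0)"
      using \<open>i \<le> j\<close> by (simp only: ij prod.inject) (auto simp only: min_def max_def split: if_splits)
    finally show ?thesis .
  qed
  have "(Phi_sym m *\<^sub>v vec_sym A) $ k = (\<Sum>p<length ?I. Phi_sym m $$ (k,p) * vec_sym A $ p)"
    using Phi_sym_carrier[of m] vec_sym_carrier[OF Ac] k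
    by (subst index_mult_mat_vec_sum) (auto simp: length_sym_idx)
  also have "\<dots> = (\<Sum>p<length ?I. (if ?I ! p = ?mn then A $$ ?mn else 0))"
    by (rule sum.cong) (auto simp: Phi vec_sym_index[OF Ac])
  also have "\<dots> = (\<Sum>q\<in>set ?I. if q = ?mn then A $$ ?mn else 0)"
    by (rule sum.reindex_bij_betw[OF bij_betw_nth[OF distinct_sym_idx]]) auto
  also have "\<dots> = A $$ ?mn"
    using rs by (subst sum.delta[OF finite_set]) (simp add: set_sym_idx min_le_iff_disj)
  also have "\<dots> = A $$ (?r,?s)"
  proof -
    have "A $$ (?r,?s) = transpose_mat A $$ (?r,?s)" using A by (simp add: sym_mats_def)
    then show ?thesis using rs Ac by (simp add: min_def max_def)
  qed
  finally show "(Phi_sym m *\<^sub>v vec_sym A) $ k = vectorize A $ k"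
    using k Ac by (simp add: vectorize_index)
qed

lemma Phi_toeplitz_carrier:
  "n > 0 \<Longrightarrow> m > 0 \<Longrightarrow> Phi_toeplitz n m \<in> carrier_mat (n * m) (m + n - 1)"
  unfolding Phi_toeplitz_def
  by (rule carrier_matI) (simp_all only: mat_of_cols_carrier length_map length_upto)

lemma Phi_toeplitz_mult:
  assumes T: "T \<in> toeplitz_mats n m" and nm: "n > 0" "m > 0"
  shows "Phi_toeplitz n m *\<^sub>v vec_toeplitz T = vectorize T"
proof (rule eq_vecI)
  have Tc: "T \<in> carrier_mat n m" using T by (rule carrier_toeplitz)
  show "dim_vec (Phi_toeplitz n m *\<^sub>v vec_toeplitz T) = dim_vec (vectorize T)"
    using Tc Phi_toeplitz_carrier[OF nm] by (auto simp: vectorize_def)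
  fix k assume "k < dim_vec (vectorize T)"
  then have k: "k < n * m" using Tc by (auto simp: vectorize_def)
  let ?r = "k mod n" and ?s = "k div n"
  let ?q = "?s + n - 1 - ?r"
  have rs: "?r < n" "?s < m" using div_mod_less[OF k] .
  have Phi: "Phi_toeplitz n m $$ (k,p) = (if p = ?q then 1 else 0)" if p: "p < m + n - 1" for p
  proof -
    let ?l = "1 - int n + int p"
    have p': "p < length [1 - int n .. int m - 1]" using p nm by (simp only: length_upto)
    have "[1 - int n .. int m - 1] ! p = ?l" using p nm by (intro nth_upto) simp
    then have "Phi_toeplitz n m $$ (k,p) = vectorize (toeplitz_basis n m ?l) $ k"
      unfolding Phi_toeplitz_def using p' k by (subst mat_of_cols_index) (simp only: length_map nth_map)+
    also have "\<dots> = toeplitz_basis n m ?l $$ (?r,?s)"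
      using k by (intro vectorize_index) (simp_all add: toeplitz_basis_def)
    also have "\<dots> = (if int ?s - int ?r = ?l then 1 else 0)"
      using rs by (simp add: toeplitz_basis_def)
    also have "int ?s - int ?r = ?l \<longleftrightarrow> p = ?q" using rs by linarith
    finally show ?thesis .
  qed
  have "(Phi_toeplitz n m *\<^sub>v vec_toeplitz T) $ k
      = (\<Sum>p<m + n - 1. Phi_toeplitz n m $$ (k,p) * vec_toeplitz T $ p)"
    using Phi_toeplitz_carrier[OF nm] vec_toeplitz_carrier[OF Tc nm] k
    by (subst index_mult_mat_vec_sum) auto
  also have "\<dots> = (\<Sum>p<m + n - 1. (if p = ?q then vec_toeplitz T $ ?q else 0))"
    by (rule sum.cong) (auto simp: Phi)
  also have "\<dots> = vec_toeplitz T $ ?q" using rs by auto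
  also have "\<dots> = T $$ (?r,?s)" using toeplitz_index[OF T rs] by simp
  finally show "(Phi_toeplitz n m *\<^sub>v vec_toeplitz T) $ k = vectorize T $ k"
    using k Tc by (simp add: vectorize_index)
qed

lemma kronecker_row_one_mult:
  assumes A: "A \<in> carrier_mat r (dim_vec x)"
  shows "(mat_of_row x \<otimes>\<^sub>K 1\<^sub>m r) *\<^sub>v vectorize A = A *\<^sub>v x"
proof (rule eq_vecI)
  show "dim_vec ((mat_of_row x \<otimes>\<^sub>K 1\<^sub>m r) *\<^sub>v vectorize A) = dim_vec (A *\<^sub>v x)"
    using A by (simp add: kronecker_def)
  fix i assume "i < dim_vec (A *\<^sub>v x)"
  then have i: "i < r" using A by auto
  let ?c = "dim_vec x"
  have "((mat_of_row x \<otimes>\<^sub>K 1\<^sub>m r) *\<^sub>v vectorize A) $ i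
     = (\<Sum>k<r * ?c. x $ (k div r) * (if i = k mod r then 1 else 0) * A $$ (k mod r, k div r))"
    using i A div_mod_less[of _ r ?c]
    by (subst index_mult_mat_vec_sum)
      (auto simp: kronecker_def vectorize_def mult.commute[of r] intro!: sum.cong)
  also have "\<dots> = (\<Sum>j<?c. \<Sum>l<r. x $ j * (if i = l then 1 else 0) * A $$ (l,j))"
    by (rule sum_div_mod)
  also have "\<dots> = (\<Sum>j<?c. A $$ (i,j) * x $ j)"
  proof (rule sum.cong[OF refl])
    fix j
    have "(\<Sum>l<r. x $ j * (if i = l then 1 else 0) * A $$ (l,j))
      = (\<Sum>l<r. if i = l then A $$ (i,j) * x $ j else 0)" by (rule sum.cong) auto
    then show "(\<Sum>l<r. x $ j * (if i = l then 1 else 0) * A $$ (l,j)) = A $$ (i,j) * x $ j"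
      using i by simp
  qed
  also have "\<dots> = (A *\<^sub>v x) $ i" using i A by (subst index_mult_mat_vec_sum) auto
  finally show "((mat_of_row x \<otimes>\<^sub>K 1\<^sub>m r) *\<^sub>v vectorize A) $ i = (A *\<^sub>v x) $ i" .
qed

lemma kronecker_one_row_mult:
  assumes B: "B \<in> carrier_mat (dim_vec y) c"
  shows "(1\<^sub>m c \<otimes>\<^sub>K mat_of_row y) *\<^sub>v vectorize B = transpose_mat B *\<^sub>v y"
proof (rule eq_vecI)
  show "dim_vec ((1\<^sub>m c \<otimes>\<^sub>K mat_of_row y) *\<^sub>v vectorize B) = dim_vec (transpose_mat B *\<^sub>v y)"
    using B by (simp add: kronecker_def)
  fix i assume "i < dim_vec (transpose_mat B *\<^sub>v y)"
  then have i: "i < c" using B by auto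
  let ?r = "dim_vec y"
  have "((1\<^sub>m c \<otimes>\<^sub>K mat_of_row y) *\<^sub>v vectorize B) $ i
     = (\<Sum>k<?r * c. (if i = k div ?r then 1 else 0) * y $ (k mod ?r) * B $$ (k mod ?r, k div ?r))"
    using i B div_mod_less[of _ ?r c]
    by (subst index_mult_mat_vec_sum)
      (auto simp: kronecker_def vectorize_def mult.commute[of c] intro!: sum.cong)
  also have "\<dots> = (\<Sum>j<c. \<Sum>l<?r. (if i = j then 1 else 0) * y $ l * B $$ (l,j))"
    by (rule sum_div_mod)
  also have "\<dots> = (\<Sum>j<c. if i = j then (\<Sum>l<?r. y $ l * B $$ (l,i)) else 0)"
    by (rule sum.cong) auto
  also have "\<dots> = (\<Sum>l<?r. B $$ (l,i) * y $ l)" using i by (simp add: mult.commute)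
  also have "\<dots> = (transpose_mat B *\<^sub>v y) $ i"
    using i B by (subst index_mult_mat_vec_sum) auto
  finally show "((1\<^sub>m c \<otimes>\<^sub>K mat_of_row y) *\<^sub>v vectorize B) $ i = (transpose_mat B *\<^sub>v y) $ i" .
qed

lemma append_cols_carrier:
  "A \<in> carrier_mat r c1 \<Longrightarrow> B \<in> carrier_mat r c2 \<Longrightarrow> A @\<^sub>c B \<in> carrier_mat r (c1 + c2)"
  by (auto simp: append_cols_def)

lemma append_cols_mult_vec:
  assumes "A \<in> carrier_mat r c1" "B \<in> carrier_mat r c2" "v \<in> carrier_vec c1" "w \<in> carrier_vec c2"
  shows "(A @\<^sub>c B) *\<^sub>v (v @\<^sub>v w) = A *\<^sub>v v + B *\<^sub>v w"
proof -
  have "(A @\<^sub>c B) *\<^sub>v (v @\<^sub>v w)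
      = (A *\<^sub>v v + B *\<^sub>v w) @\<^sub>v (0\<^sub>m 0 (dim_col A) *\<^sub>v v + 0\<^sub>m 0 (dim_col B) *\<^sub>v w)"
    unfolding append_cols_def using assms by (intro four_block_mat_mult_vec) auto
  then show ?thesis using assms by (auto intro!: eq_vecI)
qed

lemma R_mat_carrier:
  assumes "x \<in> carrier_vec m" "y \<in> carrier_vec n"
  shows "R_mat x y \<in> carrier_mat (m + n) (m * m + (n * m + n * n))"
proof -
  have "dim_vec x = m" "dim_vec y = n" using assms by auto
  then show ?thesis
    by (auto simp: R_mat_def Let_def append_rows_def append_cols_def kronecker_def mult.commute)
qed

text \<open>\<open>\<R>\<close> rewrites the product of a saddle point matrix with the solution as a linear function of
  the stacked blocks of the matrix.\<close>

lemma R_mat_mult: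
  assumes x: "x \<in> carrier_vec m" and y: "y \<in> carrier_vec n"
    and A: "A \<in> carrier_mat m m" and B: "B \<in> carrier_mat n m" and D: "D \<in> carrier_mat n n"
  shows "R_mat x y *\<^sub>v (vectorize A @\<^sub>v vectorize B @\<^sub>v vectorize D) = saddle_mat A B D *\<^sub>v (x @\<^sub>v y)"
proof -
  have d: "dim_vec x = m" "dim_vec y = n" using x y by auto
  have c: "mat_of_row x \<otimes>\<^sub>K 1\<^sub>m m \<in> carrier_mat m (m * m)"
    "1\<^sub>m m \<otimes>\<^sub>K mat_of_row y \<in> carrier_mat m (n * m)"
    "mat_of_row x \<otimes>\<^sub>K 1\<^sub>m n \<in> carrier_mat n (n * m)"
    "mat_of_row y \<otimes>\<^sub>K 1\<^sub>m n \<in> carrier_mat n (n * n)"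
    using d by (auto simp: kronecker_def mult.commute)
  have v: "vectorize A \<in> carrier_vec (m * m)" "vectorize B \<in> carrier_vec (n * m)"
    "vectorize D \<in> carrier_vec (n * n)"
    using A B D by (auto intro: vectorize_carrier)
  have k: "(mat_of_row x \<otimes>\<^sub>K 1\<^sub>m m) *\<^sub>v vectorize A = A *\<^sub>v x"
    "(1\<^sub>m m \<otimes>\<^sub>K mat_of_row y) *\<^sub>v vectorize B = transpose_mat B *\<^sub>v y"
    "(mat_of_row x \<otimes>\<^sub>K 1\<^sub>m n) *\<^sub>v vectorize B = B *\<^sub>v x"
    "(mat_of_row y \<otimes>\<^sub>K 1\<^sub>m n) *\<^sub>v vectorize D = D *\<^sub>v y"
    using A B D d by (auto intro: kronecker_row_one_mult kronecker_one_row_mult)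
  have "R_mat x y *\<^sub>v (vectorize A @\<^sub>v vectorize B @\<^sub>v vectorize D) =
    (A *\<^sub>v x + (transpose_mat B *\<^sub>v y + 0\<^sub>m m (n * n) *\<^sub>v vectorize D)) @\<^sub>v
    (0\<^sub>m n (m * m) *\<^sub>v vectorize A + (B *\<^sub>v x + D *\<^sub>v y))"
    unfolding R_mat_def Let_def d
    apply (subst mat_mult_append[where ?nr1.0 = m and ?nr2.0 = n and nc = "m * m + (n * m + n * n)"])
       apply (auto intro!: append_cols_carrier c v)[3]
    apply (subst append_cols_mult_vec[OF c(1) _ v(1)], (auto intro!: append_cols_carrier c v)[2])
    apply (subst append_cols_mult_vec[OF c(2) _ v(2,3)], simp)
    apply (subst append_cols_mult_vec[OF _ _ v(1)], (auto intro!: append_cols_carrier c v)[3])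
    apply (subst append_cols_mult_vec[OF c(3,4) v(2,3)])
    by (simp add: k)
  also have "\<dots> = (A *\<^sub>v x + transpose_mat B *\<^sub>v y) @\<^sub>v (B *\<^sub>v x + D *\<^sub>v y)"
  proof -
    have "0\<^sub>m m (n * n) *\<^sub>v vectorize D = 0\<^sub>v m" "0\<^sub>m n (m * m) *\<^sub>v vectorize A = 0\<^sub>v n"
      using v by (auto intro!: eq_vecI)
    then show ?thesis using A B D x y by simp
  qed
  also have "\<dots> = saddle_mat A B D *\<^sub>v (x @\<^sub>v y)"
    unfolding saddle_mat_def using A B D x y by (intro four_block_mat_mult_vec[symmetric]) auto
  finally show ?thesis .
qed

lemma diag_block_mat_Cons_mult_vec:
  assumes "A \<in> carrier_mat r c" "diag_block_mat As \<in> carrier_mat r' c'"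
    and "v \<in> carrier_vec c" "w \<in> carrier_vec c'"
  shows "diag_block_mat (A # As) *\<^sub>v (v @\<^sub>v w) = A *\<^sub>v v @\<^sub>v diag_block_mat As *\<^sub>v w"
proof -
  let ?B = "diag_block_mat As"
  have "diag_block_mat (A # As) = four_block_mat A (0\<^sub>m r c') (0\<^sub>m r' c) ?B"
    using assms by (simp add: Let_def)
  also have "\<dots> *\<^sub>v (v @\<^sub>v w) = (A *\<^sub>v v + 0\<^sub>m r c' *\<^sub>v w) @\<^sub>v (0\<^sub>m r' c *\<^sub>v v + ?B *\<^sub>v w)"
    using assms by (intro four_block_mat_mult_vec) auto
  also have "0\<^sub>m r c' *\<^sub>v w = 0\<^sub>v r" using assms by (auto intro!: eq_vecI)
  also have "0\<^sub>m r' c *\<^sub>v v = 0\<^sub>v r'" using assms by (auto intro!: eq_vecI)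
  finally show ?thesis using assms by simp
qed

lemma diag_block_mat_carrier_3:
  assumes "A \<in> carrier_mat r1 c1" "B \<in> carrier_mat r2 c2" "C \<in> carrier_mat r3 c3"
  shows "diag_block_mat [B, C] \<in> carrier_mat (r2 + r3) (c2 + c3)"
    "diag_block_mat [A, B, C] \<in> carrier_mat (r1 + (r2 + r3)) (c1 + (c2 + c3))"
  using assms by (auto simp: Let_def)

lemma diag_block_mat_3_mult_vec:
  assumes "A \<in> carrier_mat r1 c1" "B \<in> carrier_mat r2 c2" "C \<in> carrier_mat r3 c3"
    and "u \<in> carrier_vec c1" "v \<in> carrier_vec c2" "w \<in> carrier_vec c3"
  shows "diag_block_mat [A, B, C] *\<^sub>v (u @\<^sub>v v @\<^sub>v w) = A *\<^sub>v u @\<^sub>v B *\<^sub>v v @\<^sub>v C *\<^sub>v w"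
proof -
  have "diag_block_mat [A, B, C] *\<^sub>v (u @\<^sub>v v @\<^sub>v w) = A *\<^sub>v u @\<^sub>v diag_block_mat [B, C] *\<^sub>v (v @\<^sub>v w)"
    using assms diag_block_mat_carrier_3(1)[OF assms(1-3)]
    by (intro diag_block_mat_Cons_mult_vec[where c' = "c2 + c3" and r' = "r2 + r3"]) auto
  also have "diag_block_mat [B, C] *\<^sub>v (v @\<^sub>v w) = B *\<^sub>v v @\<^sub>v diag_block_mat [C] *\<^sub>v w"
    using assms by (intro diag_block_mat_Cons_mult_vec[where c' = c3 and r' = r3])
      (simp_all only: diag_block_mat_singleton)
  finally show ?thesis by (simp only: diag_block_mat_singleton)
qed

text \<open>The number of free parameters of the structure \<open>\<E>\<close>.\<close>

abbreviation gen_dim :: "nat \<Rightarrow> nat \<Rightarrow> nat" where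
  "gen_dim m n \<equiv> m * (m + 1) div 2 + (m + n - 1 + n * n)"

text \<open>A triple of blocks with the structure \<open>\<E>\<close>, and the vector of its free parameters.\<close>

definition structured :: "nat \<Rightarrow> nat \<Rightarrow> real mat \<Rightarrow> real mat \<Rightarrow> real mat \<Rightarrow> bool" where
  "structured m n A B D \<longleftrightarrow> A \<in> sym_mats m \<and> B \<in> toeplitz_mats n m \<and> D \<in> carrier_mat n n"

definition gen_vec :: "real mat \<Rightarrow> real mat \<Rightarrow> real mat \<Rightarrow> real vec" where
  "gen_vec A B D = vec_sym A @\<^sub>v vec_toeplitz B @\<^sub>v vectorize D"

lemma structured_carrier:
  "structured m n A B D \<Longrightarrow> A \<in> carrier_mat m m \<and> B \<in> carrier_mat n m \<and> D \<in> carrier_mat n n"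
  by (simp add: structured_def carrier_sym carrier_toeplitz)

lemma gen_parts_carrier:
  assumes "structured m n A B D" "n > 0" "m > 0"
  shows "vec_sym A \<in> carrier_vec (m * (m + 1) div 2)" "vec_toeplitz B \<in> carrier_vec (m + n - 1)"
    "vectorize D \<in> carrier_vec (n * n)"
  using structured_carrier[OF assms(1)] assms vec_sym_carrier vec_toeplitz_carrier vectorize_carrier
  by blast+

lemma gen_vec_carrier:
  "structured m n A B D \<Longrightarrow> n > 0 \<Longrightarrow> m > 0 \<Longrightarrow> gen_vec A B D \<in> carrier_vec (gen_dim m n)"
  unfolding gen_vec_def by (intro append_carrier_vec gen_parts_carrier)

lemma gen_vec_index:
  assumes "structured m n A B D" "n > 0" "m > 0"
  shows "p < m * (m + 1) div 2 \<Longrightarrow> gen_vec A B D $ p = vec_sym A $ p"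
    "p < m + n - 1 \<Longrightarrow> gen_vec A B D $ (m * (m + 1) div 2 + p) = vec_toeplitz B $ p"
    "p < n * n \<Longrightarrow> gen_vec A B D $ (m * (m + 1) div 2 + (m + n - 1 + p)) = vectorize D $ p"
  using carrier_vecD[OF gen_parts_carrier(1)[OF assms]] carrier_vecD[OF gen_parts_carrier(2)[OF assms]]
    carrier_vecD[OF gen_parts_carrier(3)[OF assms]]
  by (simp_all add: gen_vec_def del: mult_Suc_right)

lemma gen_vec_surj:
  assumes v: "v \<in> carrier_vec (gen_dim m n)" and nm: "n > 0" "m > 0"
  obtains A B D where "structured m n A B D" "gen_vec A B D = v"
proof -
  let ?w = "vec_last v (m + n - 1 + n * n)"
  have v_eq: "v = vec_first v (m * (m + 1) div 2) @\<^sub>v ?w"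
    using vec_first_last_append[OF v] by simp
  have "?w = vec_first ?w (m + n - 1) @\<^sub>v vec_last ?w (n * n)"
    by (rule vec_first_last_append[symmetric]) simp
  moreover obtain A where "A \<in> sym_mats m" "vec_sym A = vec_first v (m * (m + 1) div 2)"
    using vec_sym_surj vec_first_carrier by blast
  moreover obtain B where "B \<in> toeplitz_mats n m" "vec_toeplitz B = vec_first ?w (m + n - 1)"
    using vec_toeplitz_surj[OF vec_first_carrier nm] by blast
  moreover obtain D where "D \<in> carrier_mat n n" "vectorize D = vec_last ?w (n * n)"
    using vectorize_surj vec_last_carrier by blast
  ultimately have "structured m n A B D" "gen_vec A B D = v"
    unfolding structured_def gen_vec_def using v_eq by simp_all
  then show ?thesis by (rule that)
qed

lemma Phi_E_carrier:
  "n > 0 \<Longrightarrow> m > 0 \<Longrightarrow> Phi_E m n \<in> carrier_mat (m * m + (n * m + n * n)) (gen_dim m n)"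
  unfolding Phi_E_def
  by (intro diag_block_mat_carrier_3 Phi_sym_carrier Phi_toeplitz_carrier) auto

lemma Phi_E_mult:
  assumes s: "structured m n A B D" and nm: "n > 0" "m > 0"
  shows "Phi_E m n *\<^sub>v gen_vec A B D = vectorize A @\<^sub>v vectorize B @\<^sub>v vectorize D"
proof -
  have "Phi_E m n *\<^sub>v gen_vec A B D = Phi_sym m *\<^sub>v vec_sym A @\<^sub>v
      Phi_toeplitz n m *\<^sub>v vec_toeplitz B @\<^sub>v 1\<^sub>m (n * n) *\<^sub>v vectorize D"
    unfolding Phi_E_def gen_vec_def
    using Phi_sym_carrier Phi_toeplitz_carrier[OF nm] one_carrier_mat gen_parts_carrier[OF s nm]
    by (rule diag_block_mat_3_mult_vec)
  then show ?thesis
    using s nm gen_parts_carrier[OF s nm]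
    by (simp add: structured_def Phi_sym_mult Phi_toeplitz_mult)
qed

lemma mat_diag_four_block:
  "four_block_mat (mat_diag a f) (0\<^sub>m a b) (0\<^sub>m b a) (mat_diag b g)
    = mat_diag (a + b) (\<lambda>i. if i < a then f i else g (i - a))"
  by (rule eq_matI) (auto simp: mat_diag_def)

lemma invertible_mat_diag:
  fixes w :: "nat \<Rightarrow> real"
  assumes "\<And>i. i < n \<Longrightarrow> w i \<noteq> 0"
  shows "mat_diag n w * mat_diag n (\<lambda>i. 1 / w i) = 1\<^sub>m n"
    "mat_diag n (\<lambda>i. 1 / w i) * mat_diag n w = 1\<^sub>m n" "invertible_mat (mat_diag n w)"
proof -
  have "mat_diag n (\<lambda>i. w i * (1 / w i)) = 1\<^sub>m n"
    using assms by (intro eq_matI) (auto simp: mat_diag_def)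
  then show *: "mat_diag n w * mat_diag n (\<lambda>i. 1 / w i) = 1\<^sub>m n"
    "mat_diag n (\<lambda>i. 1 / w i) * mat_diag n w = 1\<^sub>m n"
    by (simp_all only: mat_diag_diag mult.commute)
  have d: "dim_row (mat_diag n w) = n" "dim_col (mat_diag n w) = n"
    "dim_row (mat_diag n (\<lambda>i. 1 / w i)) = n" by (simp_all add: mat_diag_def)
  show "invertible_mat (mat_diag n w)"
    unfolding invertible_mat_def inverts_mat_def square_mat.simps d
    by (intro conjI exI[of _ "mat_diag n (\<lambda>i. 1 / w i)"]) (simp_all only: d *)
qed

lemma D_E_carrier: "D_E m n \<in> carrier_mat (gen_dim m n) (gen_dim m n)"
  unfolding D_E_def D_sym_def D_toeplitz_def
  by (intro diag_block_mat_carrier_3 mat_diag_dim) auto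

lemma invertible_D_E:
  assumes "n > 0" "m > 0"
  shows "invertible_mat (D_E m n)"
proof -
  obtain f where f: "D_sym m = mat_diag (m * (m + 1) div 2) f" "\<And>i. f i \<noteq> 0"
    unfolding D_sym_def by fastforce
  obtain g where g: "D_toeplitz n m = mat_diag (m + n - 1) g" "\<And>i. i < m + n - 1 \<Longrightarrow> g i \<noteq> 0"
  proof
    show "D_toeplitz n m
        = mat_diag (m + n - 1) (\<lambda>j. sqrt (real (Min {j + 1, m, n, m + n - (j + 1)})))"
      by (rule D_toeplitz_def)
  qed (use assms in auto)
  have 2: "diag_block_mat [mat_diag b g, 1\<^sub>m c]
      = mat_diag (b + c) (\<lambda>i. if i < b then g i else 1)" for b c :: nat
    using mat_diag_four_block[of b g c "\<lambda>_. 1"]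
    by (subst diag_block_mat.simps) (simp only: diag_block_mat_singleton Let_def mat_diag_one
        mat_diag_dim[THEN carrier_matD(1)] mat_diag_dim[THEN carrier_matD(2)] index_one_mat)
  have 3: "D_E m n = mat_diag (gen_dim m n) (\<lambda>i. if i < m * (m + 1) div 2 then f i
     else if i - m * (m + 1) div 2 < m + n - 1 then g (i - m * (m + 1) div 2) else 1)"
    unfolding D_E_def f g
    by (subst diag_block_mat.simps) (simp only: 2 Let_def mat_diag_four_block
        mat_diag_dim[THEN carrier_matD(1)] mat_diag_dim[THEN carrier_matD(2)])
  show ?thesis unfolding 3 using f g by (intro invertible_mat_diag) auto
qed

section \<open>Frobenius norm and entries of the data matrix\<close>

lemma norm2_append_sq: "(norm2 (v @\<^sub>v w))\<^sup>2 = (norm2 v)\<^sup>2 + (norm2 w)\<^sup>2"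
  by (simp add: norm2_def sum_nonneg sum_lessThan_add)

lemma frob_norm_four_block_sq:
  assumes "A \<in> carrier_mat a c" "B \<in> carrier_mat a d" "C \<in> carrier_mat b c" "D \<in> carrier_mat b d"
  shows "(frob_norm (four_block_mat A B C D))\<^sup>2
    = (frob_norm A)\<^sup>2 + (frob_norm B)\<^sup>2 + (frob_norm C)\<^sup>2 + (frob_norm D)\<^sup>2"
  using assms by (simp add: frob_norm_sq sum_lessThan_add sum.distrib)

lemma frob_norm_zero: "frob_norm (0\<^sub>m r c) = 0"
  by (simp add: frob_norm_def)

lemma frob_norm_mat_of_col: "frob_norm (mat_of_col v) = norm2 v"
  by (simp add: frob_norm_def norm2_def mat_of_col_def mat_of_cols_index)

lemma frob_norm_append_cols_sq:
  assumes "A \<in> carrier_mat r c1" "B \<in> carrier_mat r c2"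
  shows "(frob_norm (A @\<^sub>c B))\<^sup>2 = (frob_norm A)\<^sup>2 + (frob_norm B)\<^sup>2"
  unfolding append_cols_def using assms
  by (subst frob_norm_four_block_sq[where a = r and b = 0 and c = c1 and d = c2])
    (auto simp: frob_norm_def)

lemma H_mat_carrier:
  "A \<in> carrier_mat m m \<Longrightarrow> D \<in> carrier_mat n n \<Longrightarrow> H_mat A B D \<in> carrier_mat (m + n) (m + n)"
  by (simp add: H_mat_def)

lemma saddle_mat_carrier:
  "A \<in> carrier_mat m m \<Longrightarrow> D \<in> carrier_mat n n \<Longrightarrow> saddle_mat A B D \<in> carrier_mat (m + n) (m + n)"
  by (simp add: saddle_mat_def)

lemma mat_of_col_carrier: "d \<in> carrier_vec r \<Longrightarrow> mat_of_col d \<in> carrier_mat r 1"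
  unfolding mat_of_col_def by (intro carrier_matI) auto

text \<open>With the weights \<open>D_E\<close> the parameter vector has the Frobenius norm of the structured matrix.\<close>

lemma frob_norm_data_sq:
  assumes s: "structured m n A B D" and nm: "n > 0" "m > 0" and d: "d \<in> carrier_vec (m + n)"
  shows "(frob_norm (H_mat A B D @\<^sub>c mat_of_col d))\<^sup>2
    = (norm2 (D_E m n *\<^sub>v gen_vec A B D @\<^sub>v d))\<^sup>2"
proof -
  have c: "A \<in> carrier_mat m m" "B \<in> carrier_mat n m" "D \<in> carrier_mat n n"
    using structured_carrier[OF s] by auto
  have "D_E m n *\<^sub>v gen_vec A B D
      = D_sym m *\<^sub>v vec_sym A @\<^sub>v D_toeplitz n m *\<^sub>v vec_toeplitz B @\<^sub>v 1\<^sub>m (n * n) *\<^sub>v vectorize D"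
    unfolding D_E_def gen_vec_def D_sym_def D_toeplitz_def
    using mat_diag_dim mat_diag_dim one_carrier_mat gen_parts_carrier[OF s nm]
    by (rule diag_block_mat_3_mult_vec)
  then have "(norm2 (D_E m n *\<^sub>v gen_vec A B D))\<^sup>2
      = (frob_norm A)\<^sup>2 + (frob_norm B)\<^sup>2 + (frob_norm D)\<^sup>2"
    using frob_norm_sym[of A m] frob_norm_toeplitz[of B n m] s nm gen_parts_carrier(3)[OF s nm]
    by (simp add: structured_def norm2_append_sq norm2_vectorize)
  moreover have "(frob_norm (H_mat A B D))\<^sup>2 = (frob_norm A)\<^sup>2 + (frob_norm B)\<^sup>2 + (frob_norm D)\<^sup>2"
    unfolding H_mat_def using c
    by (subst frob_norm_four_block_sq[where a = m and b = n and c = m and d = n])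
      (auto simp: frob_norm_zero)
  ultimately show ?thesis
    using frob_norm_append_cols_sq[OF H_mat_carrier[OF c(1,3)] mat_of_col_carrier[OF d], of B]
    by (simp add: norm2_append_sq frob_norm_mat_of_col)
qed

lemma data_mat_entries:
  assumes "H \<in> carrier_mat N N" "d \<in> carrier_vec N" "i < N"
  shows "j < N \<Longrightarrow> (H @\<^sub>c mat_of_col d) $$ (i,j) = H $$ (i,j)"
    "(H @\<^sub>c mat_of_col d) $$ (i,N) = d $ i"
    "dim_row (H @\<^sub>c mat_of_col d) = N" "dim_col (H @\<^sub>c mat_of_col d) = Suc N"
  using assms by (auto simp: append_cols_def mat_of_col_def mat_of_cols_index)

lemma data_mat_abs_le_iff:
  assumes H: "H \<in> carrier_mat N N" "d \<in> carrier_vec N" and H': "H' \<in> carrier_mat N N" "d' \<in> carrier_vec N"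
    and "N > 0"
  shows "abs_mat (H @\<^sub>c mat_of_col d) \<le> \<eta> \<cdot>\<^sub>m abs_mat (H' @\<^sub>c mat_of_col d') \<longleftrightarrow>
    (\<forall>i<N. \<forall>j<N. \<bar>H $$ (i,j)\<bar> \<le> \<eta> * \<bar>H' $$ (i,j)\<bar>) \<and> (\<forall>i<N. \<bar>d $ i\<bar> \<le> \<eta> * \<bar>d' $ i\<bar>)"
proof -
  let ?X = "H @\<^sub>c mat_of_col d" and ?Y = "H' @\<^sub>c mat_of_col d'"
  have "abs_mat ?X \<le> \<eta> \<cdot>\<^sub>m abs_mat ?Y \<longleftrightarrow>
      (\<forall>i<N. \<forall>j<Suc N. \<bar>?X $$ (i,j)\<bar> \<le> \<eta> * \<bar>?Y $$ (i,j)\<bar>)"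
    using data_mat_entries(3,4)[OF H \<open>N > 0\<close>] data_mat_entries(3,4)[OF H' \<open>N > 0\<close>]
    by (simp add: less_eq_mat_def)
  also have "\<dots> \<longleftrightarrow> (\<forall>i<N. (\<forall>j<N. \<bar>H $$ (i,j)\<bar> \<le> \<eta> * \<bar>H' $$ (i,j)\<bar>) \<and> \<bar>d $ i\<bar> \<le> \<eta> * \<bar>d' $ i\<bar>)"
    using data_mat_entries(1,2)[OF H] data_mat_entries(1,2)[OF H'] by (simp add: All_less_Suc conj_commute)
  finally show ?thesis by blast
qed

lemma structured_abs: "structured m n A B D \<Longrightarrow> structured m n (abs_mat A) (abs_mat B) (abs_mat D)"
proof -
  assume s: "structured m n A B D"
  then obtain t where "\<forall>i<n. \<forall>j<m. B $$ (i,j) = t (int j - int i)"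
    by (auto simp: structured_def toeplitz_mats_def)
  then have "\<forall>i<n. \<forall>j<m. abs_mat B $$ (i,j) = \<bar>t (int j - int i)\<bar>"
    using structured_carrier[OF s] by auto
  then have "abs_mat B \<in> toeplitz_mats n m"
    using structured_carrier[OF s] unfolding toeplitz_mats_def by (auto intro: exI[of _ "\<lambda>l. \<bar>t l\<bar>"])
  moreover have "transpose_mat (abs_mat A) = abs_mat (transpose_mat A)"
    by (rule eq_matI) auto
  ultimately show ?thesis
    using s by (auto simp: structured_def sym_mats_def)
qed

text \<open>The parameters of a structured matrix are entries of it, and every entry that is not
  structurally zero is a parameter; both at positions that do not depend on the matrix.\<close>

lemma gen_vec_is_entry:
  assumes nm: "n > 0" "m > 0" and p: "p < gen_dim m n"
  shows "\<exists>i<m + n. \<exists>j<m + n. \<forall>A B D. structured m n A B D \<longrightarrow> gen_vec A B D $ p = H_mat A B D $$ (i,j)"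
proof -
  let ?a = "m * (m + 1) div 2"
  consider "p < ?a" | "p \<ge> ?a" "p - ?a < m + n - 1" | "p \<ge> ?a + (m + n - 1)" by linarith
  then show ?thesis
  proof cases
    case 1
    then obtain i j where ij: "i < m" "j < m" "\<forall>A\<in>carrier_mat m m. vec_sym A $ p = A $$ (i,j)"
      using vec_sym_entry by blast
    have "gen_vec A B D $ p = H_mat A B D $$ (i,j)" if s: "structured m n A B D" for A B D
      using ij structured_carrier[OF s] gen_vec_index(1)[OF s nm 1] by (auto simp: H_mat_def)
    then show ?thesis using ij by (metis trans_less_add1)
  next
    case 2
    then obtain i j where ij: "i < n" "j < m" "\<forall>T\<in>carrier_mat n m. vec_toeplitz T $ (p - ?a) = T $$ (i,j)"
      using vec_toeplitz_entry[OF nm] by blast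
    have "gen_vec A B D $ p = H_mat A B D $$ (m + i,j)" if s: "structured m n A B D" for A B D
      using ij 2 structured_carrier[OF s] gen_vec_index(2)[OF s nm 2(2)] by (auto simp: H_mat_def)
    then show ?thesis using ij by (metis trans_less_add1 nat_add_left_cancel_less)
  next
    case 3
    define k where "k = p - ?a - (m + n - 1)"
    have k: "k < n * n" using 3 p k_def by linarith
    note dm = div_mod_less[OF k]
    have "gen_vec A B D $ p = H_mat A B D $$ (m + k mod n, m + k div n)"
      if s: "structured m n A B D" for A B D
    proof -
      have "?a + (m + n - 1 + k) = p" using 3 k_def by linarith
      then have "gen_vec A B D $ p = D $$ (k mod n, k div n)"
        using gen_vec_index(3)[OF s nm k] vectorize_index[OF _ k] structured_carrier[OF s] by metis
      then show ?thesis using dm structured_carrier[OF s] by (auto simp: H_mat_def)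
    qed
    then show ?thesis using dm by (metis nat_add_left_cancel_less)
  qed
qed

lemma H_mat_entry_is_gen:
  assumes nm: "n > 0" "m > 0" and i: "i < m + n" and j: "j < m + n"
  shows "(\<forall>A B D. structured m n A B D \<longrightarrow> H_mat A B D $$ (i,j) = 0) \<or>
    (\<exists>p<gen_dim m n. \<forall>A B D. structured m n A B D \<longrightarrow> H_mat A B D $$ (i,j) = gen_vec A B D $ p)"
proof -
  let ?a = "m * (m + 1) div 2"
  consider "i < m" "j < m" | "i < m" "j \<ge> m" | "i \<ge> m" "j < m" | "i \<ge> m" "j \<ge> m" by linarith
  then show ?thesis
  proof cases
    case 1
    then obtain p where p: "p < ?a" "\<forall>A\<in>sym_mats m. A $$ (i,j) = vec_sym A $ p"
      using sym_entry_vec_sym by blast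
    have "H_mat A B D $$ (i,j) = gen_vec A B D $ p" if s: "structured m n A B D" for A B D
      using p 1 s structured_carrier[OF s] gen_vec_index(1)[OF s nm p(1)]
      by (auto simp: H_mat_def structured_def)
    then show ?thesis using p by (metis trans_less_add1)
  next
    case 2
    have "H_mat A B D $$ (i,j) = 0" if s: "structured m n A B D" for A B D
      using 2 j structured_carrier[OF s] by (auto simp: H_mat_def)
    then show ?thesis by blast
  next
    case 3
    let ?p = "j + n - 1 - (i - m)"
    have p: "?p < m + n - 1" using 3 nm i by linarith
    have "H_mat A B D $$ (i,j) = gen_vec A B D $ (?a + ?p)" if s: "structured m n A B D" for A B D
    proof -
      have "B $$ (i - m, j) = vec_toeplitz B $ ?p"
        using s 3 i by (intro toeplitz_index) (auto simp: structured_def)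
      then have "gen_vec A B D $ (?a + ?p) = B $$ (i - m, j)" using gen_vec_index(2)[OF s nm p] by simp
      then show ?thesis using 3 i structured_carrier[OF s] by (auto simp: H_mat_def)
    qed
    moreover have "?a + ?p < gen_dim m n" using p by linarith
    ultimately show ?thesis by blast
  next
    case 4
    let ?k = "(j - m) * n + (i - m)"
    have k: "?k < n * n" using 4 i j by (intro column_major_position) auto
    have "H_mat A B D $$ (i,j) = gen_vec A B D $ (?a + (m + n - 1 + ?k))"
      if s: "structured m n A B D" for A B D
    proof -
      have "D $$ (i - m, j - m) = vectorize D $ ?k"
        using structured_carrier[OF s] 4 i j by (intro entry_vectorize) auto
      then have "gen_vec A B D $ (?a + (m + n - 1 + ?k)) = D $$ (i - m, j - m)"
        using gen_vec_index(3)[OF s nm k] by simp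
      then show ?thesis using 4 i j structured_carrier[OF s] by (auto simp: H_mat_def)
    qed
    moreover have "?a + (m + n - 1 + ?k) < gen_dim m n" using k by linarith
    ultimately show ?thesis by blast
  qed
qed

lemma abs_H_mat: "abs_mat (H_mat A B D) = H_mat (abs_mat A) (abs_mat B) (abs_mat D)"
  if "structured m n A B D"
  using structured_carrier[OF that] by (intro eq_matI) (auto simp: H_mat_def)

text \<open>Hence an entrywise bound relative to a structured matrix is one on the parameters.\<close>

lemma H_mat_abs_le_iff:
  assumes s: "structured m n A B D" and s': "structured m n A' B' D'" and nm: "n > 0" "m > 0"
    and \<eta>: "\<eta> \<ge> 0"
  shows "(\<forall>i<m + n. \<forall>j<m + n. \<bar>H_mat A' B' D' $$ (i,j)\<bar> \<le> \<eta> * \<bar>H_mat A B D $$ (i,j)\<bar>) \<longleftrightarrow>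
    (\<forall>p<gen_dim m n. \<bar>gen_vec A' B' D' $ p\<bar> \<le> \<eta> * gen_vec (abs_mat A) (abs_mat B) (abs_mat D) $ p)"
    (is "?l \<longleftrightarrow> ?r")
proof -
  let ?h = "gen_vec (abs_mat A) (abs_mat B) (abs_mat D)"
  have H: "H_mat (abs_mat A) (abs_mat B) (abs_mat D) $$ (i,j) = \<bar>H_mat A B D $$ (i,j)\<bar>"
    if "i < m + n" "j < m + n" for i j
    using that H_mat_carrier[of A m D n B] structured_carrier[OF s]
    by (subst abs_H_mat[OF s, symmetric]) auto
  show ?thesis
  proof
    assume l: ?l
    show ?r
    proof (intro allI impI)
      fix p assume "p < gen_dim m n"
      then obtain i j where ij: "i < m + n" "j < m + n"
        "\<forall>A B D. structured m n A B D \<longrightarrow> gen_vec A B D $ p = H_mat A B D $$ (i,j)"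
        using gen_vec_is_entry[OF nm] by blast
      then show "\<bar>gen_vec A' B' D' $ p\<bar> \<le> \<eta> * ?h $ p"
        using l s' structured_abs[OF s] H by simp
    qed
  next
    assume r: ?r
    show ?l
    proof (intro allI impI)
      fix i j assume ij: "i < m + n" "j < m + n"
      from H_mat_entry_is_gen[OF nm this]
      show "\<bar>H_mat A' B' D' $$ (i,j)\<bar> \<le> \<eta> * \<bar>H_mat A B D $$ (i,j)\<bar>"
      proof
        assume "\<forall>A B D. structured m n A B D \<longrightarrow> H_mat A B D $$ (i,j) = 0"
        then show ?thesis using s s' by simp
      next
        assume "\<exists>p<gen_dim m n. \<forall>A B D. structured m n A B D \<longrightarrow> H_mat A B D $$ (i,j) = gen_vec A B D $ p"
        then obtain p where "p < gen_dim m n"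
          "\<forall>A B D. structured m n A B D \<longrightarrow> H_mat A B D $$ (i,j) = gen_vec A B D $ p" by blast
        then show ?thesis using r s' structured_abs[OF s] H[OF ij] by metis
      qed
    qed
  qed
qed

section \<open>Structured perturbations of the saddle point problem\<close>

lemma H_mat_in_struct_E_iff:
  assumes "A \<in> carrier_mat m m" "B \<in> carrier_mat n m" "D \<in> carrier_mat n n"
  shows "H_mat A B D \<in> struct_E m n \<longleftrightarrow> structured m n A B D"
proof
  assume "H_mat A B D \<in> struct_E m n"
  then obtain A' B' D' where s: "structured m n A' B' D'" and eq: "H_mat A B D = H_mat A' B' D'"
    by (auto simp: struct_E_def structured_def)
  note c = structured_carrier[OF s]
  have ent: "H_mat A B D $$ k = H_mat A' B' D' $$ k" for k using eq by simp
  have "A = A'"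
  proof (rule eq_matI)
    fix i j assume "i < dim_row A'" "j < dim_col A'"
    then show "A $$ (i,j) = A' $$ (i,j)" using ent[of "(i,j)"] assms c by (auto simp: H_mat_def)
  qed (use assms c in auto)
  moreover have "B = B'"
  proof (rule eq_matI)
    fix i j assume "i < dim_row B'" "j < dim_col B'"
    then show "B $$ (i,j) = B' $$ (i,j)" using ent[of "(m + i,j)"] assms c by (auto simp: H_mat_def)
  qed (use assms c in auto)
  moreover have "D = D'"
  proof (rule eq_matI)
    fix i j assume "i < dim_row D'" "j < dim_col D'"
    then show "D $$ (i,j) = D' $$ (i,j)" using ent[of "(m + i,m + j)"] assms c by (auto simp: H_mat_def)
  qed (use assms c in auto)
  ultimately show "structured m n A B D" using s by simp
qed (auto simp: struct_E_def structured_def)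

lemma saddle_mat_add:
  assumes "A \<in> carrier_mat m m" "B \<in> carrier_mat n m" "D \<in> carrier_mat n n"
    "A' \<in> carrier_mat m m" "B' \<in> carrier_mat n m" "D' \<in> carrier_mat n n"
  shows "saddle_mat (A + A') (B + B') (D + D') = saddle_mat A B D + saddle_mat A' B' D'"
  unfolding saddle_mat_def using assms
  by (subst add_four_block_mat[where ?nr1.0 = m and ?nr2.0 = n and ?nc1.0 = m and ?nc2.0 = n])
    (auto simp: transpose_add)

lemma carrier_vec_append_cases:
  assumes "v \<in> carrier_vec (m + n)"
  obtains a b where "a \<in> carrier_vec m" "b \<in> carrier_vec n" "v = a @\<^sub>v b"
  using vec_first_last_append[OF assms] vec_first_carrier vec_last_carrier by metis

lemma perturbations_iff:
  assumes s: "structured m n A B D" and f: "f \<in> carrier_vec m" and g: "g \<in> carrier_vec n"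
    and x: "x \<in> carrier_vec m" and y: "y \<in> carrier_vec n"
  shows "(dH, dd, dz) \<in> perturbations A B D f g x y \<longleftrightarrow>
    (\<exists>dA dB dD. structured m n dA dB dD \<and> dH = H_mat dA dB dD \<and>
      dd \<in> carrier_vec (m + n) \<and> dz \<in> carrier_vec (m + n) \<and>
      unique_solution (saddle_mat A B D + saddle_mat dA dB dD) ((f @\<^sub>v g) + dd) ((x @\<^sub>v y) + dz))"
    (is "?l \<longleftrightarrow> ?r")
proof
  note c = structured_carrier[OF s]
  have dims: "dim_row A = m" "dim_row D = n" using c by auto
  {
    assume ?l
    then obtain dA dB dD df dg dx dy where *: "dH = H_mat dA dB dD" "dd = df @\<^sub>v dg" "dz = dx @\<^sub>v dy"
      "dA \<in> carrier_mat m m" "dB \<in> carrier_mat n m" "dD \<in> carrier_mat n n"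
      "df \<in> carrier_vec m" "dg \<in> carrier_vec n" "dx \<in> carrier_vec m" "dy \<in> carrier_vec n"
      "H_mat dA dB dD \<in> struct_E m n"
      "unique_solution (saddle_mat (A + dA) (B + dB) (D + dD))
          ((f + df) @\<^sub>v (g + dg)) ((x + dx) @\<^sub>v (y + dy))"
      unfolding perturbations_def Let_def dims by auto
    then have "structured m n dA dB dD" by (simp add: H_mat_in_struct_E_iff)
    then show ?r
      using * c f g x y
      by (intro exI[of _ dA] exI[of _ dB] exI[of _ dD])
        (auto simp: saddle_mat_add[of A m B n D] append_vec_add[of _ m _ _ n])
  next
    assume ?r
    then obtain dA dB dD where *: "structured m n dA dB dD" "dH = H_mat dA dB dD"
      "dd \<in> carrier_vec (m + n)" "dz \<in> carrier_vec (m + n)"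
      "unique_solution (saddle_mat A B D + saddle_mat dA dB dD) ((f @\<^sub>v g) + dd) ((x @\<^sub>v y) + dz)"
      by blast
    obtain df dg where df: "df \<in> carrier_vec m" "dg \<in> carrier_vec n" "dd = df @\<^sub>v dg"
      using *(3) by (rule carrier_vec_append_cases)
    obtain dx dy where dx: "dx \<in> carrier_vec m" "dy \<in> carrier_vec n" "dz = dx @\<^sub>v dy"
      using *(4) by (rule carrier_vec_append_cases)
    note c' = structured_carrier[OF *(1)]
    have "unique_solution (saddle_mat (A + dA) (B + dB) (D + dD))
          ((f + df) @\<^sub>v (g + dg)) ((x + dx) @\<^sub>v (y + dy))"
      using *(5) c c' f g x y df dx
      by (simp add: saddle_mat_add[of A m B n D] append_vec_add[of _ m _ _ n])
    then show ?l
      unfolding perturbations_def Let_def dims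
      using c' df dx * H_mat_in_struct_E_iff[of dA m dB n dD] by blast
  }
qed

lemma saddle_mat_entry_le:
  assumes s: "structured m n A B D"
    and H: "\<And>i j. i < m + n \<Longrightarrow> j < m + n \<Longrightarrow> \<bar>H_mat A B D $$ (i,j)\<bar> \<le> c"
    and ij: "i < m + n" "j < m + n"
  shows "\<bar>saddle_mat A B D $$ (i,j)\<bar> \<le> c"
proof (cases "i < m \<and> j \<ge> m")
  case True
  then have "saddle_mat A B D $$ (i,j) = H_mat A B D $$ (j,i)"
    using structured_carrier[OF s] ij by (auto simp: H_mat_def saddle_mat_def)
  then show ?thesis using H ij by simp
next
  case False
  then have "saddle_mat A B D $$ (i,j) = H_mat A B D $$ (i,j)"
    using structured_carrier[OF s] ij by (auto simp: H_mat_def saddle_mat_def)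
  then show ?thesis using H ij by simp
qed

section \<open>The limits of the suprema\<close>

text \<open>A saddle point problem with the structure \<open>\<E>\<close>, its solution \<open>(x, y)\<close>, and a matrix \<open>L\<close> whose
  value at the solution is nonzero.\<close>

locale structured_saddle_point =
  fixes m n k :: nat and A B D L :: "real mat" and f g x y :: "real vec"
  assumes pos: "n > 0" "m > 0" "k > 0"
    and data: "structured m n A B D"
    and vecs: "f \<in> carrier_vec m" "g \<in> carrier_vec n" "x \<in> carrier_vec m" "y \<in> carrier_vec n"
    and L: "L \<in> carrier_mat k (m + n)"
    and inv: "invertible_mat (saddle_mat A B D)"
    and sol: "saddle_mat A B D *\<^sub>v (x @\<^sub>v y) = f @\<^sub>v g"
    and Lz: "L *\<^sub>v (x @\<^sub>v y) \<noteq> 0\<^sub>v k"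
begin

abbreviation "N \<equiv> m + n"
abbreviation "M \<equiv> saddle_mat A B D"
abbreviation "Mi \<equiv> mat_inv (saddle_mat A B D)"
abbreviation "z \<equiv> x @\<^sub>v y"
abbreviation "d \<equiv> f @\<^sub>v g"
abbreviation "K \<equiv> L * Mi"
abbreviation "G \<equiv> L * Mi * R_mat x y * Phi_E m n"

text \<open>The first-order change \<open>L M\<^sup>-\<^sup>1 (dd - dM z)\<close> of \<open>L z\<close> under a perturbation of the data, where \<open>dM\<close>
  is the saddle point matrix of the perturbation.\<close>

definition linear_change :: "real mat \<Rightarrow> real mat \<Rightarrow> real mat \<Rightarrow> real vec \<Rightarrow> real vec" where
  "linear_change dA dB dD dd = K *\<^sub>v (dd - saddle_mat dA dB dD *\<^sub>v z)"

lemma carriers: "M \<in> carrier_mat N N" "Mi \<in> carrier_mat N N" "z \<in> carrier_vec N" "d \<in> carrier_vec N"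
  "K \<in> carrier_mat k N" "R_mat x y \<in> carrier_mat N (m * m + (n * m + n * n))"
  "Phi_E m n \<in> carrier_mat (m * m + (n * m + n * n)) (gen_dim m n)"
  "G \<in> carrier_mat k (gen_dim m n)"
proof -
  show 1: "M \<in> carrier_mat N N" using structured_carrier[OF data] by (simp add: saddle_mat_carrier)
  show 2: "Mi \<in> carrier_mat N N" by (rule mat_inv_inverse[OF 1 inv])
  show "z \<in> carrier_vec N" "d \<in> carrier_vec N" using vecs by auto
  show 3: "K \<in> carrier_mat k N" using L 2 by (rule mult_carrier_mat)
  show 4: "R_mat x y \<in> carrier_mat N (m * m + (n * m + n * n))" using vecs by (intro R_mat_carrier)
  show 5: "Phi_E m n \<in> carrier_mat (m * m + (n * m + n * n)) (gen_dim m n)"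
    using pos by (intro Phi_E_carrier)
  show "G \<in> carrier_mat k (gen_dim m n)" by (rule mult_carrier_mat[OF mult_carrier_mat[OF 3 4] 5])
qed

lemma R_Phi_gen:
  assumes s: "structured m n dA dB dD"
  shows "R_mat x y *\<^sub>v (Phi_E m n *\<^sub>v gen_vec dA dB dD) = saddle_mat dA dB dD *\<^sub>v z"
  using structured_carrier[OF s] vecs by (simp add: Phi_E_mult[OF s pos(1,2)] R_mat_mult)

lemma linear_change_index:
  assumes s: "structured m n dA dB dD" and dd: "dd \<in> carrier_vec N" and i: "i < k"
  shows "linear_change dA dB dD dd $ i
    = (\<Sum>j<N. K $$ (i,j) * dd $ j) - (\<Sum>p<gen_dim m n. G $$ (i,p) * gen_vec dA dB dD $ p)"
proof -
  let ?S = "saddle_mat dA dB dD"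
  have S: "?S *\<^sub>v z \<in> carrier_vec N"
    using structured_carrier[OF s] carriers(3) by (meson mult_mat_vec_carrier saddle_mat_carrier)
  have gen: "gen_vec dA dB dD \<in> carrier_vec (gen_dim m n)" using gen_vec_carrier[OF s] pos by simp
  have "G *\<^sub>v gen_vec dA dB dD = K *\<^sub>v (R_mat x y *\<^sub>v (Phi_E m n *\<^sub>v gen_vec dA dB dD))"
    using assoc_mult_mat_vec[OF mult_carrier_mat[OF carriers(5,6)] carriers(7) gen]
      assoc_mult_mat_vec[OF carriers(5,6) mult_mat_vec_carrier[OF carriers(7) gen]] by simp
  then have "linear_change dA dB dD dd = K *\<^sub>v dd - G *\<^sub>v gen_vec dA dB dD"
    unfolding linear_change_def R_Phi_gen[OF s] using carriers(5) dd S
    by (simp add: mult_minus_distrib_mat_vec)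
  then have "linear_change dA dB dD dd $ i = (K *\<^sub>v dd) $ i - (G *\<^sub>v gen_vec dA dB dD) $ i"
    using carrier_matD(1)[OF carriers(8)] i by (simp only: index_minus_vec dim_mult_mat_vec)
  moreover have "(K *\<^sub>v dd) $ i = (\<Sum>j<N. K $$ (i,j) * dd $ j)"
    using carriers(5) dd i by (subst index_mult_mat_vec_sum) auto
  moreover have "(G *\<^sub>v gen_vec dA dB dD) $ i = (\<Sum>p<gen_dim m n. G $$ (i,p) * gen_vec dA dB dD $ p)"
    using carriers(8) gen i by (subst index_mult_mat_vec_sum) auto
  ultimately show ?thesis by simp
qed

lemma linear_change_carrier: "linear_change dA dB dD dd \<in> carrier_vec k"
  unfolding linear_change_def using carriers(5) by (intro carrier_vecI) auto

text \<open>The limit for a general measure \<open>\<nu>\<close> of the change and a general admissibility of the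
  perturbations: it is \<open>V / c\<^sub>0\<close> if \<open>\<nu>\<close> is Lipschitz, admissibility for \<open>\<eta>\<close> bounds the entries by a multiple
  of \<open>\<eta>\<close>, and the first-order change of admissible perturbations has size at most \<open>\<eta> V\<close> and reaches this
  value up to \<open>\<eta>\<^sup>2\<close>.\<close>

lemma sup_tendsto:
  fixes Adm :: "real \<Rightarrow> real mat \<Rightarrow> real vec \<Rightarrow> bool" and \<nu> :: "real vec \<Rightarrow> real"
  assumes c: "c \<ge> 0" and c0: "c0 > 0" and \<kappa>: "\<kappa> \<ge> 0"
    and bound: "\<And>\<eta> dH dd i. 0 < \<eta> \<Longrightarrow> dH \<in> carrier_mat N N \<Longrightarrow> dd \<in> carrier_vec N \<Longrightarrow> Adm \<eta> dH dd \<Longrightarrow> i < N \<Longrightarrow>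
      (\<forall>j<N. \<bar>dH $$ (i,j)\<bar> \<le> c * \<eta>) \<and> \<bar>dd $ i\<bar> \<le> c * \<eta>"
    and lip: "\<And>v w e. v \<in> carrier_vec k \<Longrightarrow> w \<in> carrier_vec k \<Longrightarrow> (\<And>i. i < k \<Longrightarrow> \<bar>v $ i - w $ i\<bar> \<le> e) \<Longrightarrow>
      \<nu> v \<le> \<nu> w + \<kappa> * e"
    and upper: "\<And>\<eta> dA dB dD dd. 0 < \<eta> \<Longrightarrow> structured m n dA dB dD \<Longrightarrow> dd \<in> carrier_vec N \<Longrightarrow>
      Adm \<eta> (H_mat dA dB dD) dd \<Longrightarrow> \<nu> (linear_change dA dB dD dd) \<le> \<eta> * V"
    and lower: "\<And>\<eta>. 0 < \<eta> \<Longrightarrow> \<exists>dA dB dD dd. structured m n dA dB dD \<and> dd \<in> carrier_vec N \<and>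
      Adm \<eta> (H_mat dA dB dD) dd \<and> \<eta> * V - \<eta>\<^sup>2 \<le> \<nu> (linear_change dA dB dD dd)"
  shows "((\<lambda>\<eta>. Sup {ereal (\<nu> (L *\<^sub>v dz) / (\<eta> * c0)) | dH dd dz.
    (dH, dd, dz) \<in> perturbations A B D f g x y \<and> Adm \<eta> dH dd}) \<longlongrightarrow> ereal (V / c0)) (at_right 0)"
proof -
  obtain \<delta> C where \<delta>: "\<delta> > 0" and C: "C \<ge> 0" and
    ex: "\<And>\<eta> E e. 0 < \<eta> \<Longrightarrow> \<eta> < \<delta> \<Longrightarrow> E \<in> carrier_mat N N \<Longrightarrow> e \<in> carrier_vec N \<Longrightarrow>
       (\<And>i j. i < N \<Longrightarrow> j < N \<Longrightarrow> \<bar>E $$ (i,j)\<bar> \<le> c * \<eta>) \<Longrightarrow>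
       \<exists>dz\<in>carrier_vec N. unique_solution (M + E) (d + e) (z + dz)" and
    rem: "\<And>\<eta> E e dz. 0 < \<eta> \<Longrightarrow> \<eta> < \<delta> \<Longrightarrow> E \<in> carrier_mat N N \<Longrightarrow> e \<in> carrier_vec N \<Longrightarrow>
       (\<And>i j. i < N \<Longrightarrow> j < N \<Longrightarrow> \<bar>E $$ (i,j)\<bar> \<le> c * \<eta>) \<Longrightarrow> (\<And>i. i < N \<Longrightarrow> \<bar>e $ i\<bar> \<le> c * \<eta>) \<Longrightarrow>
       dz \<in> carrier_vec N \<Longrightarrow> (M + E) *\<^sub>v (z + dz) = d + e \<Longrightarrow>
       norm1 (dz - Mi *\<^sub>v (e - E *\<^sub>v z)) \<le> C * \<eta>\<^sup>2"
    by (rule perturbed_system[OF carriers(1,2) mat_inv_inverse(3)[OF carriers(1) inv]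
          carriers(3,4) sol c]) blast
  define C' where "C' = k * frob_norm L * C"
  have entries: "\<bar>saddle_mat dA dB dD $$ (i,j)\<bar> \<le> c * \<eta>"
    if "0 < \<eta>" "structured m n dA dB dD" "dd \<in> carrier_vec N" "Adm \<eta> (H_mat dA dB dD) dd"
      "i < N" "j < N" for \<eta> dA dB dD dd i j
    using that H_mat_carrier[of dA m dD n dB] structured_carrier[OF that(2)] bound[of \<eta> "H_mat dA dB dD" dd]
    by (intro saddle_mat_entry_le[OF that(2)]) auto
  have close: "\<bar>(L *\<^sub>v dz) $ i - linear_change dA dB dD dd $ i\<bar> \<le> C' * \<eta>\<^sup>2"
    if \<eta>: "0 < \<eta>" "\<eta> < \<delta>" and s: "structured m n dA dB dD" and dd: "dd \<in> carrier_vec N"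
      and dz: "dz \<in> carrier_vec N" and Adm: "Adm \<eta> (H_mat dA dB dD) dd"
      and us: "unique_solution (M + saddle_mat dA dB dD) (d + dd) (z + dz)" and i: "i < k"
    for \<eta> dA dB dD dd dz i
  proof -
    let ?E = "saddle_mat dA dB dD"
    let ?r = "dd - ?E *\<^sub>v z"
    have E: "?E \<in> carrier_mat N N" using structured_carrier[OF s] by (simp add: saddle_mat_carrier)
    have r: "?r \<in> carrier_vec N" using E dd carriers(3) by (meson minus_carrier_vec mult_mat_vec_carrier)
    have H: "H_mat dA dB dD \<in> carrier_mat N N"
      using structured_carrier[OF s] by (simp add: H_mat_carrier)
    have "norm1 (dz - Mi *\<^sub>v ?r) \<le> C * \<eta>\<^sup>2"
      using us bound[OF \<eta>(1) H dd Adm] entries[OF \<eta>(1) s dd Adm]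
      by (intro rem[OF \<eta> E dd _ _ dz]) (auto simp: unique_solution_def)
    then have "k * frob_norm L * norm1 (dz - Mi *\<^sub>v ?r) \<le> k * frob_norm L * (C * \<eta>\<^sup>2)"
      using frob_norm_nonneg[of L] by (intro mult_left_mono) auto
    moreover have "norm1 (L *\<^sub>v (dz - Mi *\<^sub>v ?r)) \<le> k * frob_norm L * norm1 (dz - Mi *\<^sub>v ?r)"
      using L dz carriers(2) r abs_entry_le_frob_norm[of _ L]
      by (intro norm1_mult_mat_vec_le[where c = N]) (auto intro: mult_mat_vec_carrier)
    moreover have "\<bar>(L *\<^sub>v (dz - Mi *\<^sub>v ?r)) $ i\<bar> \<le> norm1 (L *\<^sub>v (dz - Mi *\<^sub>v ?r))"
      using L i by (intro abs_index_le_norm1) auto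
    moreover have "L *\<^sub>v (dz - Mi *\<^sub>v ?r) = L *\<^sub>v dz - linear_change dA dB dD dd"
      unfolding linear_change_def
      using mult_minus_distrib_mat_vec[OF L dz mult_mat_vec_carrier[OF carriers(2) r]]
        assoc_mult_mat_vec[OF L carriers(2) r] by simp
    then have "(L *\<^sub>v (dz - Mi *\<^sub>v ?r)) $ i = (L *\<^sub>v dz) $ i - linear_change dA dB dD dd $ i"
      using linear_change_carrier[of dA dB dD dd] i by (simp del: index_mult_mat_vec)
    ultimately show ?thesis by (simp add: C'_def)
  qed
  have Ldz: "L *\<^sub>v dz \<in> carrier_vec k" if "dz \<in> carrier_vec N" for dz
    using L that by (rule mult_mat_vec_carrier)
  define Q where "Q \<eta> = {\<nu> (L *\<^sub>v dz) | dH dd dz.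
    (dH, dd, dz) \<in> perturbations A B D f g x y \<and> Adm \<eta> dH dd}" for \<eta>
  have "((\<lambda>\<eta>. Sup ((\<lambda>a. ereal (a / (\<eta> * c0))) ` Q \<eta>)) \<longlongrightarrow> ereal (V / c0)) (at_right 0)"
  proof (rule scaled_sup_tendsto[OF c0 \<delta>])
    fix \<eta> a assume \<eta>: "0 < \<eta>" "\<eta> < \<delta>" and "a \<in> Q \<eta>"
    then obtain dA dB dD dd dz where p: "a = \<nu> (L *\<^sub>v dz)" "structured m n dA dB dD"
      "dd \<in> carrier_vec N" "dz \<in> carrier_vec N" "Adm \<eta> (H_mat dA dB dD) dd"
      "unique_solution (M + saddle_mat dA dB dD) (d + dd) (z + dz)"
      unfolding Q_def perturbations_iff[OF data vecs] by auto
    have "a \<le> \<nu> (linear_change dA dB dD dd) + \<kappa> * (C' * \<eta>\<^sup>2)"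
      unfolding p(1) using p \<eta> by (intro lip Ldz linear_change_carrier close)
    also have "\<nu> (linear_change dA dB dD dd) \<le> \<eta> * V" using p \<eta> by (intro upper)
    finally show "a \<le> \<eta> * V + (\<kappa> * C' + 1) * \<eta>\<^sup>2"
      by (simp add: algebra_simps) (smt (verit) zero_le_power2)
  next
    fix \<eta> assume \<eta>: "0 < \<eta>" "\<eta> < \<delta>"
    obtain dA dB dD dd where p: "structured m n dA dB dD" "dd \<in> carrier_vec N"
      "Adm \<eta> (H_mat dA dB dD) dd" "\<eta> * V - \<eta>\<^sup>2 \<le> \<nu> (linear_change dA dB dD dd)"
      using lower[OF \<eta>(1)] by blast
    have "saddle_mat dA dB dD \<in> carrier_mat N N"
      using structured_carrier[OF p(1)] by (simp add: saddle_mat_carrier)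
    then obtain dz where dz: "dz \<in> carrier_vec N"
      "unique_solution (M + saddle_mat dA dB dD) (d + dd) (z + dz)"
      using ex[OF \<eta> _ p(2)] entries[OF \<eta>(1) p(1-3)] by blast
    then have "\<nu> (L *\<^sub>v dz) \<in> Q \<eta>"
      unfolding Q_def perturbations_iff[OF data vecs] using p by blast
    moreover have "\<nu> (linear_change dA dB dD dd) \<le> \<nu> (L *\<^sub>v dz) + \<kappa> * (C' * \<eta>\<^sup>2)"
    proof (rule lip[OF linear_change_carrier Ldz[OF dz(1)]])
      fix i assume "i < k"
      from close[OF \<eta> p(1,2) dz(1) p(3) dz(2) this]
      show "\<bar>linear_change dA dB dD dd $ i - (L *\<^sub>v dz) $ i\<bar> \<le> C' * \<eta>\<^sup>2" by linarith
    qed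
    then have "\<eta> * V - (\<kappa> * C' + 1) * \<eta>\<^sup>2 \<le> \<nu> (L *\<^sub>v dz)"
      using p(4) by (simp add: algebra_simps)
    ultimately show "\<exists>a\<in>Q \<eta>. \<eta> * V - (\<kappa> * C' + 1) * \<eta>\<^sup>2 \<le> a" by blast
  qed
  moreover have "(\<lambda>a. ereal (a / (\<eta> * c0))) ` Q \<eta> = {ereal (\<nu> (L *\<^sub>v dz) / (\<eta> * c0)) | dH dd dz.
    (dH, dd, dz) \<in> perturbations A B D f g x y \<and> Adm \<eta> dH dd}" for \<eta>
    unfolding Q_def by blast
  ultimately show ?thesis by simp
qed

subsection \<open>Normwise\<close>

text \<open>The matrix \<open>W\<close> takes the weighted parameters of a perturbation, whose Euclidean length is the
  Frobenius norm of the perturbation, to the negative of the first-order change.\<close>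

abbreviation "W \<equiv> L * Mi * ((R_mat x y * Phi_E m n * mat_inv (D_E m n)) @\<^sub>c (- 1\<^sub>m (m + n)))"

abbreviation "data_norm \<equiv> frob_norm (H_mat A B D @\<^sub>c mat_of_col d)"

lemma W_carrier: "W \<in> carrier_mat k (gen_dim m n + N)"
  and W_mult: "structured m n dA dB dD \<Longrightarrow> dd \<in> carrier_vec N \<Longrightarrow>
    W *\<^sub>v (D_E m n *\<^sub>v gen_vec dA dB dD @\<^sub>v dd) = - linear_change dA dB dD dd"
proof -
  note Di = mat_inv_inverse[OF D_E_carrier invertible_D_E[OF pos(1,2)]]
  let ?P = "R_mat x y * Phi_E m n"
  have P: "?P \<in> carrier_mat N (gen_dim m n)" using carriers(6,7) by (rule mult_carrier_mat)
  have PD: "?P * mat_inv (D_E m n) \<in> carrier_mat N (gen_dim m n)" using P Di(1) by (rule mult_carrier_mat)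
  have I: "- 1\<^sub>m N \<in> carrier_mat N N" by simp
  note X = append_cols_carrier[OF PD I]
  show "W \<in> carrier_mat k (gen_dim m n + N)" using carriers(5) X by (rule mult_carrier_mat)
  assume s: "structured m n dA dB dD" and dd: "dd \<in> carrier_vec N"
  let ?v = "gen_vec dA dB dD"
  have v: "?v \<in> carrier_vec (gen_dim m n)" using gen_vec_carrier[OF s pos(1,2)] .
  have S: "saddle_mat dA dB dD *\<^sub>v z \<in> carrier_vec N"
    using structured_carrier[OF s] carriers(3) by (meson mult_mat_vec_carrier saddle_mat_carrier)
  have Dv: "D_E m n *\<^sub>v ?v \<in> carrier_vec (gen_dim m n)" using D_E_carrier v by (rule mult_mat_vec_carrier)
  have "?P * mat_inv (D_E m n) *\<^sub>v (D_E m n *\<^sub>v ?v) = ?P *\<^sub>v ((mat_inv (D_E m n) * D_E m n) *\<^sub>v ?v)"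
    using assoc_mult_mat_vec[OF P Di(1) Dv] assoc_mult_mat_vec[OF Di(1) D_E_carrier v] by simp
  also have "\<dots> = saddle_mat dA dB dD *\<^sub>v z"
    using Di(3) v assoc_mult_mat_vec[OF carriers(6,7) v] R_Phi_gen[OF s] by simp
  finally have "((?P * mat_inv (D_E m n)) @\<^sub>c (- 1\<^sub>m N)) *\<^sub>v (D_E m n *\<^sub>v ?v @\<^sub>v dd)
      = saddle_mat dA dB dD *\<^sub>v z + (- 1\<^sub>m N) *\<^sub>v dd"
    by (simp add: append_cols_mult_vec[OF PD I Dv dd])
  also have "saddle_mat dA dB dD *\<^sub>v z + (- 1\<^sub>m N) *\<^sub>v dd = - (dd - saddle_mat dA dB dD *\<^sub>v z)"
  proof -
    have "a + (- 1\<^sub>m N) *\<^sub>v dd = - (dd - a)" if "a \<in> carrier_vec N" for a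
      using dd that by (intro eq_vecI) auto
    then show ?thesis using S .
  qed
  finally have "W *\<^sub>v (D_E m n *\<^sub>v ?v @\<^sub>v dd) = K *\<^sub>v (- (dd - saddle_mat dA dB dD *\<^sub>v z))"
    using assoc_mult_mat_vec[OF carriers(5) X append_carrier_vec[OF Dv dd]] by simp
  also have "\<dots> = - linear_change dA dB dD dd"
    unfolding linear_change_def using carrier_matD(2)[OF carriers(5)] carrier_vecD[OF S]
    by (intro mult_mat_vec_uminus) (simp only: index_minus_vec)
  finally show "W *\<^sub>v (D_E m n *\<^sub>v ?v @\<^sub>v dd) = - linear_change dA dB dD dd" .
qed

lemma data_norm_eq:
  assumes "structured m n dA dB dD" "dd \<in> carrier_vec N"
  shows "frob_norm (H_mat dA dB dD @\<^sub>c mat_of_col dd) = norm2 (D_E m n *\<^sub>v gen_vec dA dB dD @\<^sub>v dd)"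
  using frob_norm_data_sq[OF assms(1) pos(1,2) assms(2)]
  by (rule power2_eq_imp_eq) (auto simp: frob_norm_nonneg norm2_nonneg)

lemma norm2_linear_change:
  "structured m n dA dB dD \<Longrightarrow> dd \<in> carrier_vec N \<Longrightarrow>
    norm2 (linear_change dA dB dD dd) = norm2 (W *\<^sub>v (D_E m n *\<^sub>v gen_vec dA dB dD @\<^sub>v dd))"
  by (simp only: W_mult norm2_uminus)

lemma normwise_tendsto:
  "(normwise_sup L A B D f g x y \<longlongrightarrow> ereal (spectral_norm W * data_norm / norm2 (L *\<^sub>v z))) (at_right 0)"
  unfolding normwise_sup_def
proof (rule sup_tendsto[where c = data_norm and \<kappa> = "real k"])
  let ?F = data_norm
  show F: "?F \<ge> 0" by (rule frob_norm_nonneg)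
  have Lzc: "L *\<^sub>v z \<in> carrier_vec k" using L carriers(3) by (rule mult_mat_vec_carrier)
  then show "norm2 (L *\<^sub>v z) > 0"
    using Lz norm2_eq_0_iff[OF Lzc] norm2_nonneg[of "L *\<^sub>v z"] by linarith
  show "real k \<ge> 0" by simp
  show "(\<forall>j<N. \<bar>dH $$ (i,j)\<bar> \<le> ?F * \<eta>) \<and> \<bar>dd $ i\<bar> \<le> ?F * \<eta>"
    if "0 < \<eta>" and c: "dH \<in> carrier_mat N N" "dd \<in> carrier_vec N"
      and le: "frob_norm (dH @\<^sub>c mat_of_col dd) \<le> \<eta> * ?F" and i: "i < N" for \<eta> dH dd i
  proof -
    have "\<bar>(dH @\<^sub>c mat_of_col dd) $$ (i,j)\<bar> \<le> ?F * \<eta>" if "j < Suc N" for j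
      using abs_entry_le_frob_norm[of i "dH @\<^sub>c mat_of_col dd" j] data_mat_entries(3,4)[OF c i] that i le
      by (simp add: mult.commute)
    then show ?thesis
      using data_mat_entries(1,2)[OF c i] by (metis lessI less_SucI)
  qed
  show "norm2 v \<le> norm2 w + real k * e"
    if "v \<in> carrier_vec k" "w \<in> carrier_vec k" "\<And>i. i < k \<Longrightarrow> \<bar>v $ i - w $ i\<bar> \<le> e" for v w e
    using that by (intro norm2_le_add_entries) auto
  show "norm2 (linear_change dA dB dD dd) \<le> \<eta> * (spectral_norm W * ?F)"
    if s: "structured m n dA dB dD" and dd: "dd \<in> carrier_vec N"
      and le: "frob_norm (H_mat dA dB dD @\<^sub>c mat_of_col dd) \<le> \<eta> * ?F" for \<eta> dA dB dD dd
  proof -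
    have "D_E m n *\<^sub>v gen_vec dA dB dD @\<^sub>v dd \<in> carrier_vec (gen_dim m n + N)"
      using gen_vec_carrier[OF s pos(1,2)] D_E_carrier dd by (meson append_carrier_vec mult_mat_vec_carrier)
    then have "norm2 (linear_change dA dB dD dd)
        \<le> spectral_norm W * norm2 (D_E m n *\<^sub>v gen_vec dA dB dD @\<^sub>v dd)"
      unfolding norm2_linear_change[OF s dd]
      using carrier_matD(2)[OF W_carrier] by (intro norm2_mult_le_spectral_norm) simp
    also have "\<dots> \<le> spectral_norm W * (\<eta> * ?F)"
      using le unfolding data_norm_eq[OF s dd]
      by (rule mult_left_mono) (rule spectral_norm_nonneg)
    finally show ?thesis by (simp add: mult_ac)
  qed
  show "\<exists>dA dB dD dd. structured m n dA dB dD \<and> dd \<in> carrier_vec N \<and>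
      frob_norm (H_mat dA dB dD @\<^sub>c mat_of_col dd) \<le> \<eta> * ?F \<and>
      \<eta> * (spectral_norm W * ?F) - \<eta>\<^sup>2 \<le> norm2 (linear_change dA dB dD dd)"
    if \<eta>: "0 < \<eta>" for \<eta>
  proof -
    note Di = mat_inv_inverse[OF D_E_carrier invertible_D_E[OF pos(1,2)]]
    \<comment> \<open>The radius is \<open>\<eta> ?F\<close>, so missing the spectral norm by \<open>\<eta> / (?F + 1)\<close> costs at most \<open>\<eta>\<^sup>2\<close>;
      the summand 1 guards against \<open>?F = 0\<close>.\<close>
    have "\<eta> / (?F + 1) > 0" using \<eta> F by (simp add: divide_pos_pos add_nonneg_pos)
    then obtain v where v: "v \<in> carrier_vec (gen_dim m n + N)" "norm2 v \<le> 1"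
      "spectral_norm W - \<eta> / (?F + 1) \<le> norm2 (W *\<^sub>v v)"
      using spectral_norm_nearly_attained[of _ W] carrier_matD(2)[OF W_carrier] by metis
    let ?u = "(\<eta> * ?F) \<cdot>\<^sub>v v"
    have "?u \<in> carrier_vec (gen_dim m n + N)" using v(1) by simp
    then obtain a dd where u: "a \<in> carrier_vec (gen_dim m n)" "dd \<in> carrier_vec N" "?u = a @\<^sub>v dd"
      by (rule carrier_vec_append_cases)
    obtain dA dB dD where s: "structured m n dA dB dD" "gen_vec dA dB dD = mat_inv (D_E m n) *\<^sub>v a"
      using gen_vec_surj[OF mult_mat_vec_carrier[OF Di(1) u(1)] pos(1,2)] .
    have "D_E m n *\<^sub>v gen_vec dA dB dD = a"
      using assoc_mult_mat_vec[OF D_E_carrier Di(1) u(1)] Di(2) u(1) by (simp add: s(2))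
    then have gen: "D_E m n *\<^sub>v gen_vec dA dB dD @\<^sub>v dd = ?u" using u(3) by simp
    have "norm2 ?u = \<eta> * ?F * norm2 v" using \<eta> F by (simp add: norm2_smult)
    also have "\<dots> \<le> \<eta> * ?F * 1" using \<eta> F v(2) by (intro mult_left_mono) auto
    finally have le: "norm2 ?u \<le> \<eta> * ?F" by simp
    have "\<eta> * ?F * (spectral_norm W - \<eta> / (?F + 1)) \<le> \<eta> * ?F * norm2 (W *\<^sub>v v)"
      using \<eta> F v(3) by (intro mult_left_mono) auto
    also have "\<dots> = norm2 (W *\<^sub>v ?u)"
      using \<eta> F mult_mat_vec[OF W_carrier v(1)] by (simp add: norm2_smult)
    finally have low: "\<eta> * ?F * (spectral_norm W - \<eta> / (?F + 1)) \<le> norm2 (W *\<^sub>v ?u)" .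
    have "?F / (?F + 1) \<le> 1" using F by simp
    then have "\<eta>\<^sup>2 * (?F / (?F + 1)) \<le> \<eta>\<^sup>2" 
      by (metis mult.right_neutral mult_left_mono zero_le_power2)
    moreover have "\<eta> * ?F * (spectral_norm W - \<eta> / (?F + 1))
        = \<eta> * (spectral_norm W * ?F) - \<eta>\<^sup>2 * (?F / (?F + 1))"
      by (simp add: algebra_simps power2_eq_square)
    ultimately have "\<eta> * (spectral_norm W * ?F) - \<eta>\<^sup>2 \<le> norm2 (W *\<^sub>v ?u)" using low by linarith
    then show ?thesis
      using s(1) u(2) le
      by (intro exI[of _ dA] exI[of _ dB] exI[of _ dD] exI[of _ dd])
        (simp add: data_norm_eq norm2_linear_change gen)
  qed
qed

subsection \<open>Mixed and componentwise\<close>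

text \<open>A perturbation with \<open>\<bar>dH\<bar> \<le> \<eta> \<bar>H\<bar>\<close> and \<open>\<bar>dd\<bar> \<le> \<eta> \<bar>d\<bar>\<close> has parameters between \<open>- \<eta> abs_gen\<close> and
  \<open>\<eta> abs_gen\<close>, so that \<open>\<eta> change_bound\<close> bounds its first-order change entrywise.\<close>

abbreviation "abs_gen \<equiv> gen_vec (abs_mat A) (abs_mat B) (abs_mat D)"

abbreviation "change_bound \<equiv> abs_mat G *\<^sub>v abs_gen + abs_mat K *\<^sub>v (abs_vec f @\<^sub>v abs_vec g)"

lemma change_bound_index:
  assumes "i < k"
  shows "change_bound $ i = (\<Sum>p<gen_dim m n. \<bar>G $$ (i,p)\<bar> * abs_gen $ p) + (\<Sum>j<N. \<bar>K $$ (i,j)\<bar> * \<bar>d $ j\<bar>)"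
proof -
  have gen: "abs_gen \<in> carrier_vec (gen_dim m n)"
    using gen_vec_carrier[OF structured_abs[OF data] pos(1,2)] .
  have "(abs_mat G *\<^sub>v abs_gen) $ i = (\<Sum>p<gen_dim m n. abs_mat G $$ (i,p) * abs_gen $ p)"
    using assms gen carriers(8) by (subst index_mult_mat_vec_sum) auto
  also have "\<dots> = (\<Sum>p<gen_dim m n. \<bar>G $$ (i,p)\<bar> * abs_gen $ p)"
    using assms carrier_matD[OF carriers(8)] by (intro sum.cong) auto
  finally have 1: "(abs_mat G *\<^sub>v abs_gen) $ i = (\<Sum>p<gen_dim m n. \<bar>G $$ (i,p)\<bar> * abs_gen $ p)" .
  have d: "abs_vec f @\<^sub>v abs_vec g = abs_vec d" by (intro eq_vecI) auto
  have "(abs_mat K *\<^sub>v abs_vec d) $ i = (\<Sum>j<N. abs_mat K $$ (i,j) * abs_vec d $ j)"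
    using assms carrier_matD[OF carriers(5)] carrier_vecD[OF carriers(4)]
    by (subst index_mult_mat_vec_sum) (simp_all only: index_map_mat index_map_vec)
  also have "\<dots> = (\<Sum>j<N. \<bar>K $$ (i,j)\<bar> * \<bar>d $ j\<bar>)"
    using assms carrier_matD[OF carriers(5)] carrier_vecD[OF carriers(4)]
    by (intro sum.cong refl arg_cong2[where f = "(*)"]) (simp_all only: index_map_mat index_map_vec lessThan_iff)
  finally have 2: "(abs_mat K *\<^sub>v abs_vec d) $ i = (\<Sum>j<N. \<bar>K $$ (i,j)\<bar> * \<bar>d $ j\<bar>)" .
  have "dim_vec (abs_mat K *\<^sub>v abs_vec d) = k" using carrier_matD[OF carriers(5)] by simp
  then show ?thesis using assms 1 2 by (simp only: d index_add_vec)
qed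

lemma change_bound_dim: "dim_vec change_bound = k"
  using carrier_matD[OF carriers(5)] by simp

lemma abs_gen_nonneg: "p < gen_dim m n \<Longrightarrow> abs_gen $ p \<ge> 0"
  using H_mat_abs_le_iff[OF data data pos(1,2), of 1] abs_ge_zero order_trans by force

lemma change_bound_nonneg: "i < k \<Longrightarrow> change_bound $ i \<ge> 0"
  using abs_gen_nonneg by (simp only: change_bound_index) (auto intro!: add_nonneg_nonneg sum_nonneg)

text \<open>In each single row the bound \<open>change_bound\<close> is attained, which suffices for a maximum norm.\<close>

lemma weighted_sup_tendsto:
  assumes c0: "c0 > 0" and \<omega>: "\<And>i. i < k \<Longrightarrow> 0 \<le> \<omega> i"
  shows "((\<lambda>\<eta>. Sup {ereal (max_norm \<omega> (L *\<^sub>v dz) / (\<eta> * c0)) | dH dd dz.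
    (dH, dd, dz) \<in> perturbations A B D f g x y \<and>
    abs_mat (dH @\<^sub>c mat_of_col dd) \<le> \<eta> \<cdot>\<^sub>m abs_mat (H_mat A B D @\<^sub>c mat_of_col d)})
    \<longlongrightarrow> ereal (max_norm \<omega> change_bound / c0)) (at_right 0)"
proof (rule sup_tendsto[where c = data_norm and \<kappa> = "\<Sum>i<k. \<omega> i"])
  let ?F = data_norm
  have H: "H_mat A B D \<in> carrier_mat N N" using structured_carrier[OF data] by (simp add: H_mat_carrier)
  have Npos: "N > 0" using pos by simp
  note adm = data_mat_abs_le_iff[OF _ _ H carriers(4) Npos]
  show "?F \<ge> 0" by (rule frob_norm_nonneg)
  show "c0 > 0" by (rule c0)
  show "(\<Sum>i<k. \<omega> i) \<ge> 0" by (rule sum_nonneg) (simp add: \<omega>)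
  show "(\<forall>j<N. \<bar>dH $$ (i,j)\<bar> \<le> ?F * \<eta>) \<and> \<bar>dd $ i\<bar> \<le> ?F * \<eta>"
    if \<eta>: "0 < \<eta>" and c: "dH \<in> carrier_mat N N" "dd \<in> carrier_vec N" and i: "i < N"
      and le: "abs_mat (dH @\<^sub>c mat_of_col dd) \<le> \<eta> \<cdot>\<^sub>m abs_mat (H_mat A B D @\<^sub>c mat_of_col d)" for \<eta> dH dd i
  proof -
    have F: "\<bar>(H_mat A B D @\<^sub>c mat_of_col d) $$ (i,j)\<bar> \<le> ?F" if "j < Suc N" for j
      using abs_entry_le_frob_norm[of i "H_mat A B D @\<^sub>c mat_of_col d" j]
        data_mat_entries(3,4)[OF H carriers(4) i] that i by simp
    have "\<bar>H_mat A B D $$ (i,j)\<bar> \<le> ?F" if "j < N" for j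
      using F[of j] that data_mat_entries(1)[OF H carriers(4) i] by simp
    moreover have "\<bar>d $ i\<bar> \<le> ?F" using F[of N] data_mat_entries(2)[OF H carriers(4) i] by simp
    ultimately show ?thesis
      using le i \<eta> unfolding adm[OF c] by (smt (verit) mult.commute mult_left_mono)
  qed
  show "max_norm \<omega> v \<le> max_norm \<omega> w + (\<Sum>i<k. \<omega> i) * e"
    if "v \<in> carrier_vec k" "w \<in> carrier_vec k" "\<And>i. i < k \<Longrightarrow> \<bar>v $ i - w $ i\<bar> \<le> e" for v w e
    using that \<omega> pos(3) by (intro max_norm_le_add_entries[where k = k]) (auto intro: member_le_sum)
  show "max_norm \<omega> (linear_change dA dB dD dd) \<le> \<eta> * max_norm \<omega> change_bound"
    if \<eta>: "0 < \<eta>" and s: "structured m n dA dB dD" and dd: "dd \<in> carrier_vec N"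
      and le: "abs_mat (H_mat dA dB dD @\<^sub>c mat_of_col dd) \<le> \<eta> \<cdot>\<^sub>m abs_mat (H_mat A B D @\<^sub>c mat_of_col d)"
    for \<eta> dA dB dD dd
  proof -
    let ?w = "linear_change dA dB dD dd"
    have dH: "H_mat dA dB dD \<in> carrier_mat N N" using structured_carrier[OF s] by (simp add: H_mat_carrier)
    have v_le: "\<bar>gen_vec dA dB dD $ p\<bar> \<le> \<eta> * abs_gen $ p" if "p < gen_dim m n" for p
      using le \<eta> that unfolding adm[OF dH dd] H_mat_abs_le_iff[OF data s pos(1,2) less_imp_le[OF \<eta>]] by blast
    have d_le: "\<bar>dd $ j\<bar> \<le> \<eta> * \<bar>d $ j\<bar>" if "j < N" for j
      using le that unfolding adm[OF dH dd] by blast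
    have "\<omega> i * \<bar>?w $ i\<bar> \<le> \<eta> * max_norm \<omega> change_bound" if i: "i < k" for i
    proof -
      have "\<bar>?w $ i\<bar> \<le> (\<Sum>p<gen_dim m n. \<bar>G $$ (i,p)\<bar> * \<bar>gen_vec dA dB dD $ p\<bar>)
          + (\<Sum>j<N. \<bar>K $$ (i,j)\<bar> * \<bar>dd $ j\<bar>)"
        unfolding linear_change_index[OF s dd i] abs_mult[symmetric]
        using sum_abs[of "\<lambda>j. K $$ (i,j) * dd $ j" "{..<N}"]
          sum_abs[of "\<lambda>p. G $$ (i,p) * gen_vec dA dB dD $ p" "{..<gen_dim m n}"] by linarith
      also have "\<dots> \<le> (\<Sum>p<gen_dim m n. \<bar>G $$ (i,p)\<bar> * (\<eta> * abs_gen $ p))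
          + (\<Sum>j<N. \<bar>K $$ (i,j)\<bar> * (\<eta> * \<bar>d $ j\<bar>))"
        using v_le d_le by (intro add_mono sum_mono mult_left_mono) auto
      also have "\<dots> = \<eta> * change_bound $ i"
        unfolding change_bound_index[OF i] distrib_left sum_distrib_left by (simp only: mult.left_commute)
      finally have "\<omega> i * \<bar>?w $ i\<bar> \<le> \<omega> i * (\<eta> * \<bar>change_bound $ i\<bar>)"
        using \<omega>[OF i] change_bound_nonneg[OF i] by (simp only: mult_left_mono abs_of_nonneg)
      also have "\<dots> = \<eta> * (\<omega> i * \<bar>change_bound $ i\<bar>)" by (rule mult.left_commute)
      also have "\<dots> \<le> \<eta> * max_norm \<omega> change_bound"
        using \<eta> i change_bound_dim by (intro mult_left_mono max_norm_ge) (simp_all only: less_imp_le)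
      finally show ?thesis .
    qed
    then show ?thesis
      using carrier_vecD[OF linear_change_carrier] pos(3) by (subst max_norm_le_iff) simp_all
  qed
  show "\<exists>dA dB dD dd. structured m n dA dB dD \<and> dd \<in> carrier_vec N \<and>
      abs_mat (H_mat dA dB dD @\<^sub>c mat_of_col dd) \<le> \<eta> \<cdot>\<^sub>m abs_mat (H_mat A B D @\<^sub>c mat_of_col d) \<and>
      \<eta> * max_norm \<omega> change_bound - \<eta>\<^sup>2 \<le> max_norm \<omega> (linear_change dA dB dD dd)"
    if \<eta>: "0 < \<eta>" for \<eta>
  proof -
    obtain i where i: "i < k" and max: "max_norm \<omega> change_bound = \<omega> i * \<bar>change_bound $ i\<bar>"
      using max_norm_attained[of change_bound \<omega>] change_bound_dim pos(3) by metis
    \<comment> \<open>The signs of the perturbation are chosen such that all terms of row \<open>i\<close> add up.\<close>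
    define v where "v = vec (gen_dim m n) (\<lambda>p. - \<eta> * sgn (G $$ (i,p)) * abs_gen $ p)"
    define dd where "dd = vec N (\<lambda>j. \<eta> * sgn (K $$ (i,j)) * \<bar>d $ j\<bar>)"
    have "v \<in> carrier_vec (gen_dim m n)" by (simp add: v_def)
    then obtain dA dB dD where s: "structured m n dA dB dD" and gen: "gen_vec dA dB dD = v"
      using gen_vec_surj pos(1,2) by blast
    have dd: "dd \<in> carrier_vec N" by (simp add: dd_def)
    have dH: "H_mat dA dB dD \<in> carrier_mat N N" using structured_carrier[OF s] by (simp add: H_mat_carrier)
    have sgn: "\<bar>\<eta> * sgn a * b\<bar> \<le> \<eta> * b" if "b \<ge> 0" for a b :: real
      using that \<eta> by (simp add: abs_mult sgn_if)
    have "\<bar>v $ p\<bar> \<le> \<eta> * abs_gen $ p" if "p < gen_dim m n" for p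
    proof -
      have "v $ p = - (\<eta> * sgn (G $$ (i,p)) * abs_gen $ p)" using that by (simp only: v_def index_vec mult_minus_left)
      then show ?thesis using sgn[OF abs_gen_nonneg[OF that]] by (simp only: abs_minus_cancel)
    qed
    moreover have "\<bar>dd $ j\<bar> \<le> \<eta> * \<bar>d $ j\<bar>" if "j < N" for j
      using sgn[of "\<bar>d $ j\<bar>"] that by (simp only: dd_def index_vec abs_ge_zero)
    ultimately have Adm: "abs_mat (H_mat dA dB dD @\<^sub>c mat_of_col dd)
        \<le> \<eta> \<cdot>\<^sub>m abs_mat (H_mat A B D @\<^sub>c mat_of_col d)"
      unfolding adm[OF dH dd] H_mat_abs_le_iff[OF data s pos(1,2) less_imp_le[OF \<eta>]] gen by blast
    have "linear_change dA dB dD dd $ i = \<eta> * change_bound $ i"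
    proof -
      have "(\<Sum>j<N. K $$ (i,j) * dd $ j) = (\<Sum>j<N. \<eta> * (\<bar>K $$ (i,j)\<bar> * \<bar>d $ j\<bar>))"
        by (rule sum.cong) (simp_all only: dd_def index_vec lessThan_iff abs_sgn mult_ac)
      moreover have "(\<Sum>p<gen_dim m n. G $$ (i,p) * v $ p)
          = - (\<Sum>p<gen_dim m n. \<eta> * (\<bar>G $$ (i,p)\<bar> * abs_gen $ p))"
        unfolding sum_negf[symmetric]
        by (rule sum.cong) (simp_all only: v_def index_vec lessThan_iff abs_sgn mult_ac mult_minus_left mult_minus_right)
      ultimately show ?thesis
        unfolding linear_change_index[OF s dd i] change_bound_index[OF i] gen
        by (simp only: sum_distrib_left distrib_left diff_minus_eq_add add.commute)
    qed
    then have "\<eta> * max_norm \<omega> change_bound = \<omega> i * \<bar>linear_change dA dB dD dd $ i\<bar>"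
      using \<eta> unfolding max by (simp only: abs_mult) simp
    also have "\<dots> \<le> max_norm \<omega> (linear_change dA dB dD dd)"
      using i carrier_vecD[OF linear_change_carrier] by (intro max_norm_ge) simp
    finally have "\<eta> * max_norm \<omega> change_bound - \<eta>\<^sup>2 \<le> max_norm \<omega> (linear_change dA dB dD dd)"
      using zero_le_power2[of \<eta>] by linarith
    then show ?thesis using s dd Adm by blast
  qed
qed

lemma mixed_tendsto:
  "(mixed_sup L A B D f g x y \<longlongrightarrow> ereal (norm_inf change_bound / norm_inf (L *\<^sub>v z))) (at_right 0)"
proof -
  have Lzc: "L *\<^sub>v z \<in> carrier_vec k" using L carriers(3) by (rule mult_mat_vec_carrier)
  then obtain i where "i < k" "(L *\<^sub>v z) $ i \<noteq> 0"
    using Lz by (metis carrier_vecD eq_vecI index_zero_vec)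
  then have "0 < norm_inf (L *\<^sub>v z)"
    using max_norm_ge[of i "L *\<^sub>v z" "\<lambda>_. 1"] carrier_vecD[OF Lzc]
    unfolding norm_inf_eq_max_norm by (metis mult_1 order_less_le_trans zero_less_abs_iff)
  from weighted_sup_tendsto[OF this, of "\<lambda>_. 1"] show ?thesis
    unfolding mixed_sup_def norm_inf_eq_max_norm by simp
qed

lemma componentwise_tendsto:
  assumes nz: "\<And>i. i < k \<Longrightarrow> (L *\<^sub>v z) $ i \<noteq> 0"
  shows "(componentwise_sup L A B D f g x y \<longlongrightarrow>
    ereal (max_norm (\<lambda>i. 1 / \<bar>(L *\<^sub>v z) $ i\<bar>) change_bound)) (at_right 0)"
proof -
  let ?\<omega> = "\<lambda>i. 1 / \<bar>(L *\<^sub>v z) $ i\<bar>"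
  have quot: "norm_inf_quot (L *\<^sub>v w) (L *\<^sub>v z) = ereal (max_norm ?\<omega> (L *\<^sub>v w))" for w
  proof -
    have k: "dim_vec (L *\<^sub>v w) = k" using L by simp
    have "ereal (max_norm ?\<omega> (L *\<^sub>v w))
        = Max (ereal ` ((\<lambda>i. ?\<omega> i * \<bar>(L *\<^sub>v w) $ i\<bar>) ` {..<k}))"
      unfolding max_norm_def k using pos(3)
      by (intro mono_Max_commute) (auto simp: mono_def)
    also have "ereal ` ((\<lambda>i. ?\<omega> i * \<bar>(L *\<^sub>v w) $ i\<bar>) ` {..<k})
        = (\<lambda>i. \<bar>quot ((L *\<^sub>v w) $ i) ((L *\<^sub>v z) $ i)\<bar>) ` {..<k}"
      unfolding image_image using nz by (intro image_cong) (simp_all add: quot_def abs_divide del: index_mult_mat_vec)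
    finally show ?thesis unfolding norm_inf_quot_def k by simp
  qed
  have "((\<lambda>\<eta>. Sup {ereal (max_norm ?\<omega> (L *\<^sub>v dz) / (\<eta> * 1)) | dH dd dz.
    (dH, dd, dz) \<in> perturbations A B D f g x y \<and>
    abs_mat (dH @\<^sub>c mat_of_col dd) \<le> \<eta> \<cdot>\<^sub>m abs_mat (H_mat A B D @\<^sub>c mat_of_col d)})
    \<longlongrightarrow> ereal (max_norm ?\<omega> change_bound / 1)) (at_right 0)"
    by (rule weighted_sup_tendsto) auto
  then show ?thesis
    unfolding componentwise_sup_def quot by (simp only: times_ereal.simps) simp
qed

end

section \<open>The Moore-Penrose inverse of a nonsingular diagonal matrix\<close>

lemma moore_penrose_eq_inverse:
  assumes A: "A \<in> carrier_mat n n" and B: "B \<in> carrier_mat n n" and "A * B = 1\<^sub>m n" "B * A = 1\<^sub>m n"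
  shows "moore_penrose A = B"
  unfolding moore_penrose_def
proof (rule the_equality)
  show "is_moore_penrose A B"
    using assms by (simp add: is_moore_penrose_def)
  fix X assume X: "is_moore_penrose A X"
  then have Xc: "X \<in> carrier_mat n n" and "A * X * A = A"
    using A by (auto simp: is_moore_penrose_def)
  have "X = (B * A) * X * (A * B)" using assms Xc by simp
  also have "\<dots> = B * (A * X * A) * B"
    using A B Xc by (simp add: assoc_mult_mat[of _ n n _ n _ n])
  also have "\<dots> = B" using \<open>A * X * A = A\<close> assms by simp
  finally show "X = B" .
qed

lemma moore_penrose_diag_of_vec:
  assumes "\<And>i. i < dim_vec c \<Longrightarrow> c $ i \<noteq> 0"
  shows "moore_penrose (diag_of_vec c) = mat_diag (dim_vec c) (\<lambda>i. 1 / c $ i)"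
  unfolding diag_of_vec_def using invertible_mat_diag[of "dim_vec c" "($) c"] assms
  by (intro moore_penrose_eq_inverse) auto

lemma mat_diag_mult_mat_vec_index:
  assumes "A \<in> carrier_mat k c" "v \<in> carrier_vec c" "i < k"
  shows "(mat_diag k w * A *\<^sub>v v) $ i = w i * (A *\<^sub>v v) $ i"
  using assms
  by (subst (1 2) index_mult_mat_vec_sum)
    (auto simp: mat_diag_mult_left sum_distrib_left mult.assoc intro!: sum.cong)

section \<open>The structured condition numbers\<close>

theorem theorem3p2:
  fixes m n k :: nat
    and A B D L :: "real mat"
    and f g x y :: "real vec"
  assumes "m > 0" and "n > 0" and "k > 0"
    and "A \<in> sym_mats m" and "B \<in> toeplitz_mats n m" and "D \<in> carrier_mat n n"
    and "f \<in> carrier_vec m" and "g \<in> carrier_vec n"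
    and "x \<in> carrier_vec m" and "y \<in> carrier_vec n"
    and "L \<in> carrier_mat k (m + n)"
    and "invertible_mat A" and "invertible_mat (saddle_mat A B D)"
    and "unique_solution (saddle_mat A B D) (f @\<^sub>v g) (x @\<^sub>v y)"
    and "L *\<^sub>v (x @\<^sub>v y) \<noteq> 0\<^sub>v k"
  shows
    "((\<exists>l. (normwise_sup L A B D f g x y \<longlongrightarrow> l) (at_right 0)) \<and>
     normwise_cond L A B D f g x y =
       ereal (spectral_norm (L * mat_inv (saddle_mat A B D) *
                ((R_mat x y * Phi_E m n * mat_inv (D_E m n)) @\<^sub>c (- 1\<^sub>m (m + n))))
              * frob_norm (H_mat A B D @\<^sub>c mat_of_col (f @\<^sub>v g))
              / norm2 (L *\<^sub>v (x @\<^sub>v y)))) \<and>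
     (x @\<^sub>v y \<noteq> 0\<^sub>v (m + n) \<longrightarrow>
     (\<exists>l. (mixed_sup L A B D f g x y \<longlongrightarrow> l) (at_right 0)) \<and>
     mixed_cond L A B D f g x y =
       ereal (norm_inf
                (abs_mat (L * mat_inv (saddle_mat A B D) * R_mat x y * Phi_E m n) *\<^sub>v
                   (vec_sym (abs_mat A) @\<^sub>v vec_toeplitz (abs_mat B) @\<^sub>v vectorize (abs_mat D))
                 + abs_mat (L * mat_inv (saddle_mat A B D)) *\<^sub>v (abs_vec f @\<^sub>v abs_vec g))
              / norm_inf (L *\<^sub>v (x @\<^sub>v y)))) \<and>
     ((\<forall>i<m. x $ i \<noteq> 0) \<and> (\<forall>i<n. y $ i \<noteq> 0) \<and> (\<forall>i<k. (L *\<^sub>v (x @\<^sub>v y)) $ i \<noteq> 0) \<longrightarrow>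
     (\<exists>l. (componentwise_sup L A B D f g x y \<longlongrightarrow> l) (at_right 0)) \<and>
     componentwise_cond L A B D f g x y =
       ereal (norm_inf
                (moore_penrose (diag_of_vec (L *\<^sub>v (x @\<^sub>v y))) *
                   abs_mat (L * mat_inv (saddle_mat A B D) * R_mat x y * Phi_E m n) *\<^sub>v
                   (vec_sym (abs_mat A) @\<^sub>v vec_toeplitz (abs_mat B) @\<^sub>v vectorize (abs_mat D))
                 + moore_penrose (diag_of_vec (L *\<^sub>v (x @\<^sub>v y))) *
                   abs_mat (L * mat_inv (saddle_mat A B D)) *\<^sub>v (abs_vec f @\<^sub>v abs_vec g))))"
proof -
  interpret structured_saddle_point m n k A B D L f g x y
    using assms by unfold_locales (auto simp: structured_def unique_solution_def)
  have lim: "(\<exists>l. (F \<longlongrightarrow> l) (at_right 0)) \<and> Lim (at_right 0) F = v"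
    if "(F \<longlongrightarrow> v) (at_right 0)" for F :: "real \<Rightarrow> ereal" and v
    using that tendsto_Lim[OF _ that] by auto
  show ?thesis
    unfolding normwise_cond_def mixed_cond_def componentwise_cond_def gen_vec_def[symmetric]
  \<comment> \<open>What remains is the componentwise formula: the Moore-Penrose inverse of the diagonal matrix only
    scales the rows by \<open>1 / (L z)\<^sub>i\<close>, which the maximum norm takes as weights.\<close>
  proof (intro conjI[OF lim[OF normwise_tendsto]] conjI impI lim[OF mixed_tendsto])
    assume nz: "(\<forall>i<m. x $ i \<noteq> 0) \<and> (\<forall>i<n. y $ i \<noteq> 0) \<and> (\<forall>i<k. (L *\<^sub>v z) $ i \<noteq> 0)"
    let ?\<omega> = "\<lambda>i. 1 / (L *\<^sub>v z) $ i"
    let ?P = "moore_penrose (diag_of_vec (L *\<^sub>v z))"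
    let ?w = "?P * abs_mat G *\<^sub>v abs_gen + ?P * abs_mat K *\<^sub>v (abs_vec f @\<^sub>v abs_vec g)"
    have dim: "dim_vec (L *\<^sub>v z) = k" using L by simp
    have P: "?P = mat_diag k ?\<omega>"
      using moore_penrose_diag_of_vec[of "L *\<^sub>v z"] nz unfolding dim by blast
    have c: "abs_mat G \<in> carrier_mat k (gen_dim m n)" "abs_mat K \<in> carrier_mat k N"
      "abs_gen \<in> carrier_vec (gen_dim m n)" "abs_vec f @\<^sub>v abs_vec g \<in> carrier_vec N"
      using carriers(5,8) gen_vec_carrier[OF structured_abs[OF data] pos(1,2)] vecs by auto
    have w_dim: "dim_vec ?w = k" unfolding P using mat_diag_dim[THEN carrier_matD(1)] by simp
    have w: "?w $ i = ?\<omega> i * change_bound $ i" if i: "i < k" for i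
    proof -
      have "?w $ i = (?P * abs_mat G *\<^sub>v abs_gen) $ i + (?P * abs_mat K *\<^sub>v (abs_vec f @\<^sub>v abs_vec g)) $ i"
        using i w_dim by (simp only: index_add_vec)
      also have "\<dots> = ?\<omega> i * (abs_mat G *\<^sub>v abs_gen) $ i + ?\<omega> i * (abs_mat K *\<^sub>v (abs_vec f @\<^sub>v abs_vec g)) $ i"
        unfolding P mat_diag_mult_mat_vec_index[OF c(1,3) i] mat_diag_mult_mat_vec_index[OF c(2,4) i] ..
      also have "\<dots> = ?\<omega> i * change_bound $ i"
        using i change_bound_dim by (simp only: index_add_vec distrib_left)
      finally show ?thesis .
    qed
    have "norm_inf ?w = max_norm (\<lambda>i. 1 / \<bar>(L *\<^sub>v z) $ i\<bar>) change_bound"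
      unfolding norm_inf_eq_max_norm max_norm_def w_dim change_bound_dim
      by (intro arg_cong[where f = Max] image_cong refl) (simp only: w lessThan_iff abs_mult abs_divide abs_one mult_1)
    then show "(\<exists>l. (componentwise_sup L A B D f g x y \<longlongrightarrow> l) (at_right 0))"
      "Lim (at_right 0) (componentwise_sup L A B D f g x y) = ereal (norm_inf ?w)"
      using lim[OF componentwise_tendsto] nz by metis+
  qed (use lim[OF mixed_tendsto] in blast)+
qed

end
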